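(* Let $k\in \mathbb{N}$, $p\in (0,1)$, and let $\nu \in \mathcal D(p,k)$ be a distribution having no pairwise independent coordinate. Then, there exists a constant $\alpha>0$, such that for every large enough $n\in \mathbb{N}$, there exists a function $f:\{0,1\}^n \to [-1,1]$ such that 1. $\left|\mathbb{E}_{X\sim \nu^{\otimes n}} \left[\prod_{i=1}^k f(X_i)\right] \right|\geq \alpha$; 2. For every $S\subseteq [n]$, it holds that $\left|\mathbb{E}_{X\sim \mu_p^{\otimes n}}\left[f(X)\chi_S(X)\right]\right| \leq o_n(1)$. Moreover, if the distribution $\nu$ is such that $\eta:= \max_{i,j\in [k], i\neq j} \Pr_{X\sim \nu}\left[X_i=X_j\right] < 1$ (that is, no two coordinates are almost surely equal), then there exists a constant $\alpha>0$ such that for every large enough $n$ there exists a function $f:\{0,1\}^n\to\{-1,1\}$ (range $\{-1,1\}$) satisfying both properties 1 and 2.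
   Context: $\mu_p$ is the distribution on $\{0,1\}$ assigning probability $p$ to 1 and $1-p$ to 0; $\mu_p^{\otimes n}$ is the $n$-fold product. For $S\subseteq[n]$, $\chi_S(x)=\prod_{i\in S}(-1)^{x_i}$. $\mathcal D(p,k)$ is the class of distributions $\nu$ on $\{0,1\}^k$ with marginal $\mu_p$ on each coordinate and $\mathrm{supp}(\nu)\subseteq\{x\in\{0,1\}^k:\sum_i x_i=0 \pmod 2\}$. A coordinate $i\in[k]$ of $\nu$ is pairwise independent if $\mathbb{E}_{X\sim\nu}[X_iX_j]=p^2$ for all $j\neq i$. For $X=(X_1,\dots,X_k)\sim\nu^{\otimes n}$, each $X_i\in\{0,1\}^n$ and the $n$ coordinate-tuples $(X_1^{(j)},\dots,X_k^{(j)})$ are i.i.d. samples from $\nu$. *)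

theory Defs
  imports "HOL-Probability.Probability"
begin

text \<open>
  Bits are booleans, \<^term>\<open>True\<close> being 1, and the index set of size \<open>n\<close> is \<^term>\<open>{..<n}\<close>.
  A point of the \<open>n\<close>-cube is a function that is \<^term>\<open>undefined\<close> outside \<^term>\<open>{..<n}\<close>; this is
  also the default value used in the product distributions, so that these live on the cube.
\<close>

definition cube :: "nat \<Rightarrow> (nat \<Rightarrow> bool) set" where
  "cube n = {..<n} \<rightarrow>\<^sub>E UNIV"

definition biased_cube :: "real \<Rightarrow> nat \<Rightarrow> (nat \<Rightarrow> bool) pmf" where
  "biased_cube p n = Pi_pmf {..<n} undefined (\<lambda>_. bernoulli_pmf p)"

definition chi :: "nat set \<Rightarrow> (nat \<Rightarrow> bool) \<Rightarrow> real" where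
  "chi S x = (\<Prod>i\<in>S. (-1) ^ (of_bool (x i) :: nat))"

definition even_dists :: "real \<Rightarrow> nat \<Rightarrow> (nat \<Rightarrow> bool) pmf set" where
  "even_dists p k =
     {\<nu>. (\<forall>i<k. map_pmf (\<lambda>x. x i) \<nu> = bernoulli_pmf p) \<and>
         set_pmf \<nu> \<subseteq> {x \<in> cube k. even (\<Sum>i<k. of_bool (x i) :: nat)}}"

definition pairwise_indep_coord :: "real \<Rightarrow> nat \<Rightarrow> (nat \<Rightarrow> bool) pmf \<Rightarrow> nat \<Rightarrow> bool" where
  "pairwise_indep_coord p k \<nu> i \<longleftrightarrow>
     (\<forall>j<k. j \<noteq> i \<longrightarrow> measure_pmf.expectation \<nu> (\<lambda>x. of_bool (x i) * of_bool (x j)) = p\<^sup>2)"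

text \<open>
  In a sample \<open>X\<close> of the \<open>n\<close>-fold product of \<open>\<nu>\<close>, \<open>X j\<close> is the \<open>j\<close>-th independent copy of \<open>\<nu>\<close>
  (a point of the \<open>k\<close>-cube), whereas \<open>coord_vec n X i\<close> is the vector \<open>X\<^sub>i\<close> in the \<open>n\<close>-cube that collects
  the \<open>i\<close>-th coordinates of all copies.
\<close>

definition power_dist :: "(nat \<Rightarrow> bool) pmf \<Rightarrow> nat \<Rightarrow> (nat \<Rightarrow> nat \<Rightarrow> bool) pmf" where
  "power_dist \<nu> n = Pi_pmf {..<n} undefined (\<lambda>_. \<nu>)"

definition coord_vec :: "nat \<Rightarrow> (nat \<Rightarrow> nat \<Rightarrow> bool) \<Rightarrow> nat \<Rightarrow> (nat \<Rightarrow> bool)" where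
  "coord_vec n X i = (\<lambda>j\<in>{..<n}. X j i)"

text \<open>
  For \<open>k < 2\<close> the maximum ranges over the empty set and is unspecified.
\<close>

definition max_agreement :: "nat \<Rightarrow> (nat \<Rightarrow> bool) pmf \<Rightarrow> real" where
  "max_agreement k \<nu> =
     Max {measure_pmf.prob \<nu> {x. x i = x j} | i j. i < k \<and> j < k \<and> i \<noteq> j}"

end

theory Submission
  imports Defs "HOL-Real_Asymp.Real_Asymp"
begin

text \<open>
  Take \<open>f\<close> to be a function of the normalised sum \<open>Z = (\<Sum>j<n. x j - p) / sqrt n\<close>, namely a linear combination
  of functions \<open>exp (v r\<^sup>2 / 2) cos (r Z) - 1\<close> with \<open>v = p (1 - p)\<close>. Each of them has mean tending to 0, and
  a character \<open>\<chi>\<^sub>S\<close> of large order is almost orthogonal to it while one of small order is almost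
  independent of it, which gives the second property. Since \<open>f\<close> is a trigonometric polynomial in \<open>Z\<close>,
  the limit of the \<open>k\<close>-fold correlation is an explicit sum of terms \<open>\<plusminus> exp (- Q u / 2)\<close>, where \<open>Q\<close>
  is the off-diagonal part of the covariance form and \<open>u i \<in> {- r i, 0, r i}\<close>. For generic
  frequencies \<open>r\<close> the minimum of \<open>Q\<close> is attained only at points without zero coordinates, because no
  coordinate is uncorrelated with all others; as the frequencies are scaled up those terms dominate,
  and their coefficients are positive. By polarisation one can use the same \<open>f\<close> in all \<open>k\<close> slots.

  If no two coordinates agree almost surely, the vectors \<open>X\<^sub>i\<close> are distinct with high probability, so
  rounding \<open>f\<close> independently at each point to a random sign of mean \<open>f x\<close> preserves the correlation on average,
  while by Hoeffding's inequality and a union bound all \<open>2 ^ n\<close> character sums change by \<open>o(1)\<close>.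
\<close>

section \<open>Expectations over product distributions\<close>

lemma finite_set_Pi_pmf:
  assumes "finite A" "\<And>x. x \<in> A \<Longrightarrow> finite (set_pmf (q x))"
  shows "finite (set_pmf (Pi_pmf A d q))"
  using assms by (auto simp: set_Pi_pmf intro!: finite_PiE_dflt)

text \<open>Independence of the coordinates gives the product rule, and finite supports supply the
  integrability. The value type is general because the factors are complex for characteristic
  functions and real for random rounding.\<close>

lemma expectation_prod_Pi_pmf_finite:
  fixes h :: "'a \<Rightarrow> 'b \<Rightarrow> 'c :: {real_normed_field, banach, second_countable_topology}"
  assumes "finite A" "\<And>x. x \<in> A \<Longrightarrow> finite (set_pmf (q x))"
  shows "measure_pmf.expectation (Pi_pmf A d q) (\<lambda>X. \<Prod>x\<in>A. h x (X x)) =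
    (\<Prod>x\<in>A. measure_pmf.expectation (q x) (h x))"
proof -
  have ind: "prob_space.indep_vars (measure_pmf (Pi_pmf A d q)) (\<lambda>_. borel) (\<lambda>x X. h x (X x)) A"
    by (rule prob_space.indep_vars_compose2[OF _ indep_vars_Pi_pmf])
       (auto simp: assms measure_pmf.prob_space_axioms)
  have "measure_pmf.expectation (Pi_pmf A d q) (\<lambda>X. \<Prod>x\<in>A. h x (X x)) =
    (\<Prod>x\<in>A. measure_pmf.expectation (Pi_pmf A d q) (\<lambda>X. h x (X x)))"
    by (rule prob_space.indep_vars_lebesgue_integral[OF measure_pmf.prob_space_axioms assms(1) ind])
       (intro integrable_measure_pmf_finite finite_set_Pi_pmf assms)
  also have "\<dots> = (\<Prod>x\<in>A. measure_pmf.expectation (q x) (h x))"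
  proof (rule prod.cong)
    fix x assume "x \<in> A"
    have "measure_pmf.expectation (Pi_pmf A d q) (\<lambda>X. h x (X x)) =
      measure_pmf.expectation (map_pmf (\<lambda>X. X x) (Pi_pmf A d q)) (h x)" by simp
    also have "\<dots> = measure_pmf.expectation (q x) (h x)"
      using \<open>x \<in> A\<close> assms(1) by (subst Pi_pmf_component) auto
    finally show "measure_pmf.expectation (Pi_pmf A d q) (\<lambda>X. h x (X x)) = \<dots>" .
  qed simp
  finally show ?thesis .
qed

section \<open>Limits of characteristic functions\<close>

text \<open>The central limit theorem in terms of characteristic functions. By a second-order Taylor
  expansion \<open>a n\<close> and \<open>b n\<close> differ by at most a multiple of
  \<open>1 / sqrt (real n) ^ 3\<close>; in the unit disc, passing to \<open>n\<close>-th powers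
  costs at most a factor \<open>n\<close>, so the error still vanishes.\<close>

lemma clt_cis:
  fixes M :: "'a pmf" and Y :: "'a \<Rightarrow> real"
  assumes fin: "finite (set_pmf M)" and mean: "measure_pmf.expectation M Y = 0"
  shows "(\<lambda>n. measure_pmf.expectation M (\<lambda>x. cis (Y x / sqrt (real n))) ^ n) \<longlonglongrightarrow>
    of_real (exp (- measure_pmf.expectation M (\<lambda>x. (Y x)\<^sup>2) / 2))"
proof -
  note [simp] = integrable_measure_pmf_finite[OF fin]
  define \<sigma> where "\<sigma> = measure_pmf.expectation M (\<lambda>x. (Y x)\<^sup>2)"
  define K where "K = measure_pmf.expectation M (\<lambda>x. \<bar>Y x\<bar> ^ 3)"
  define a where "a = (\<lambda>n. measure_pmf.expectation M (\<lambda>x. cis (Y x / sqrt (real n))))"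
  define b where "b = (\<lambda>n. complex_of_real (1 + (- \<sigma> / 2) / real n))"
  have taylor: "cmod (cis y - (1 + \<i> * y - y\<^sup>2 / 2)) \<le> \<bar>y\<bar> ^ 3 / 6" for y :: real
    using iexp_approx1[of y 2]
    by (simp add: cis_conv_exp numeral_eq_Suc atMost_Suc algebra_simps power2_eq_square)
  have ab: "cmod (a n - b n) \<le> K / (6 * sqrt (real n) ^ 3)" if "n > 0" for n
  proof -
    let ?s = "sqrt (real n)"
    have "b n = measure_pmf.expectation M
        (\<lambda>x. 1 + \<i> * complex_of_real (Y x / ?s) - complex_of_real ((Y x / ?s)\<^sup>2 / 2))"
    proof -
      have "measure_pmf.expectation M
          (\<lambda>x. 1 + \<i> * complex_of_real (Y x / ?s) - complex_of_real ((Y x / ?s)\<^sup>2 / 2))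
        = 1 + \<i> * of_real (measure_pmf.expectation M (\<lambda>x. Y x / ?s))
            - of_real (measure_pmf.expectation M (\<lambda>x. (Y x / ?s)\<^sup>2 / 2))"
        unfolding integral_complex_of_real[symmetric] by (simp del: of_real_divide of_real_power)
      also have "\<dots> = b n"
        using that mean by (simp add: b_def \<sigma>_def power_divide)
      finally show ?thesis by simp
    qed
    then have "cmod (a n - b n) = cmod (measure_pmf.expectation M
        (\<lambda>x. cis (Y x / ?s) - (1 + \<i> * complex_of_real (Y x / ?s) - complex_of_real ((Y x / ?s)\<^sup>2 / 2))))"
      unfolding a_def by (subst Bochner_Integration.integral_diff) auto
    also have "\<dots> \<le> measure_pmf.expectation M (\<lambda>x. \<bar>Y x / ?s\<bar> ^ 3 / 6)"
      by (rule order_trans[OF integral_norm_bound], rule integral_mono)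
         (use taylor[of "Y x / ?s" for x] in auto)
    also have "\<dots> = K / (6 * ?s ^ 3)"
      using that by (simp add: K_def power_divide field_simps)
    finally show ?thesis .
  qed
  have "(\<lambda>n. a n ^ n - b n ^ n) \<longlonglongrightarrow> 0"
  proof (rule Lim_null_comparison)
    show "\<forall>\<^sub>F n in sequentially. norm (a n ^ n - b n ^ n) \<le> real n * (K / (6 * sqrt (real n) ^ 3))"
      \<comment> \<open>For \<open>n\<close> at least \<open>\<sigma>\<close> the real number
        \<open>b n\<close> lies in the unit interval, so that \<open>norm_power_diff\<close>
        applies.\<close>
      using eventually_gt_at_top[of "nat \<lceil>\<sigma>\<rceil>"] eventually_gt_at_top[of 0]
    proof eventually_elim
      case (elim n)
      have "\<sigma> \<ge> 0" unfolding \<sigma>_def by simp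
      moreover have "\<sigma> \<le> n" using elim by linarith
      ultimately have "cmod (b n) \<le> 1"
        unfolding b_def norm_of_real using elim by (auto simp: field_simps abs_le_iff)
      moreover have "cmod (a n) \<le> 1" unfolding a_def
        by (rule order_trans[OF integral_norm_bound]) simp
      ultimately have "cmod (a n ^ n - b n ^ n) \<le> real n * cmod (a n - b n)"
        by (intro norm_power_diff)
      also have "\<dots> \<le> real n * (K / (6 * sqrt (real n) ^ 3))"
        using ab elim by (intro mult_left_mono) auto
      finally show ?case .
    qed
    show "(\<lambda>n. real n * (K / (6 * sqrt (real n) ^ 3))) \<longlonglongrightarrow> 0"
      by real_asymp
  qed
  moreover have "(\<lambda>n. b n ^ n) \<longlonglongrightarrow> of_real (exp (- \<sigma> / 2))"
    unfolding b_def of_real_power[symmetric]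
    by (intro tendsto_of_real tendsto_exp_limit_sequentially)
  ultimately have "(\<lambda>n. (a n ^ n - b n ^ n) + b n ^ n) \<longlonglongrightarrow> 0 + of_real (exp (- \<sigma> / 2))"
    by (rule tendsto_add)
  then show ?thesis by (simp add: a_def \<sigma>_def)
qed

section \<open>Joint Gaussian limit of the normalised sums\<close>

definition zstat :: "real \<Rightarrow> nat \<Rightarrow> (nat \<Rightarrow> bool) \<Rightarrow> real" where
  "zstat p n x = (\<Sum>j<n. of_bool (x j) - p) / sqrt (real n)"

text \<open>For \<open>\<nu>\<close> in \<open>even_dists p k\<close> and indices below
  \<open>k\<close> this is the true covariance, all means being \<open>p\<close>.\<close>

definition covar :: "real \<Rightarrow> (nat \<Rightarrow> bool) pmf \<Rightarrow> nat \<Rightarrow> nat \<Rightarrow> real" where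
  "covar p \<nu> i j = measure_pmf.expectation \<nu> (\<lambda>x. (of_bool (x i) - p) * (of_bool (x j) - p))"

lemma finite_cube: "finite (cube n)"
  by (simp add: cube_def finite_PiE)

lemma cis_sum: "finite A \<Longrightarrow> cis (\<Sum>a\<in>A. f a) = (\<Prod>a\<in>A. cis (f a))"
  by (induction A rule: finite_induct) (auto simp flip: cis_mult)

lemma finite_even_dists: "\<nu> \<in> even_dists p k \<Longrightarrow> finite (set_pmf \<nu>)"
  by (rule finite_subset[OF _ finite_cube[of k]]) (auto simp: even_dists_def)

lemma mean_even_dists:
  fixes g :: "bool \<Rightarrow> real"
  assumes "\<nu> \<in> even_dists p k" "i < k" "0 \<le> p" "p \<le> 1"
  shows "measure_pmf.expectation \<nu> (\<lambda>x. g (x i)) = p * g True + (1 - p) * g False"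
proof -
  have "measure_pmf.expectation \<nu> (\<lambda>x. g (x i)) = measure_pmf.expectation (map_pmf (\<lambda>x. x i) \<nu>) g"
    by simp
  also have "map_pmf (\<lambda>x. x i) \<nu> = bernoulli_pmf p"
    using assms by (auto simp: even_dists_def)
  finally show ?thesis using assms by simp
qed

lemma finite_power_dist: "finite (set_pmf \<nu>) \<Longrightarrow> finite (set_pmf (power_dist \<nu> n))"
  unfolding power_dist_def by (rule finite_set_Pi_pmf) auto

text \<open>A linear combination of the normalised sums is itself a normalised sum of
  \<open>Y\<close> over the \<open>n\<close> independent copies of \<open>\<nu>\<close>. So the
  one-dimensional limit suffices, and the variance of \<open>Y\<close> is the covariance form at
  \<open>t\<close>.\<close>

lemma tendsto_power_dist_cis:
  assumes \<nu>: "\<nu> \<in> even_dists p k" and p: "0 \<le> p" "p \<le> 1"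
  shows "(\<lambda>n. measure_pmf.expectation (power_dist \<nu> n)
      (\<lambda>X. cis (\<Sum>i<k. t i * zstat p n (coord_vec n X i)))) \<longlonglongrightarrow>
    of_real (exp (- (\<Sum>i<k. \<Sum>j<k. covar p \<nu> i j * t i * t j) / 2))"
proof -
  note fin = finite_even_dists[OF \<nu>]
  note [simp] = integrable_measure_pmf_finite[OF fin]
  define Y where "Y = (\<lambda>x :: nat \<Rightarrow> bool. \<Sum>i<k. t i * (of_bool (x i) - p))"
  have "measure_pmf.expectation \<nu> Y = 0"
    unfolding Y_def using mean_even_dists[OF \<nu> _ p, of _ "\<lambda>b. of_bool b - p"]
    by (auto intro!: sum.neutral simp: algebra_simps)
  from clt_cis[OF fin this]
  have "(\<lambda>n. measure_pmf.expectation \<nu> (\<lambda>x. cis (Y x / sqrt (real n))) ^ n) \<longlonglongrightarrow>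
    of_real (exp (- measure_pmf.expectation \<nu> (\<lambda>x. (Y x)\<^sup>2) / 2))" .
  also have "measure_pmf.expectation \<nu> (\<lambda>x. (Y x)\<^sup>2) = (\<Sum>i<k. \<Sum>j<k. covar p \<nu> i j * t i * t j)"
  proof -
    have "(Y x)\<^sup>2 = (\<Sum>i<k. \<Sum>j<k. (of_bool (x i) - p) * (of_bool (x j) - p) * (t i * t j))" for x
      unfolding Y_def power2_eq_square sum_product by (simp add: mult_ac)
    then have "measure_pmf.expectation \<nu> (\<lambda>x. (Y x)\<^sup>2) = (\<Sum>i<k. \<Sum>j<k. covar p \<nu> i j * (t i * t j))"
      unfolding covar_def by simp
    then show ?thesis by (simp add: mult.assoc)
  qed
  also have "(\<lambda>n. measure_pmf.expectation \<nu> (\<lambda>x. cis (Y x / sqrt (real n))) ^ n) =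
    (\<lambda>n. measure_pmf.expectation (power_dist \<nu> n)
      (\<lambda>X. cis (\<Sum>i<k. t i * zstat p n (coord_vec n X i))))"
  proof
    fix n
    have "cis (\<Sum>i<k. t i * zstat p n (coord_vec n X i)) = (\<Prod>j<n. cis (Y (X j) / sqrt (real n)))" for X
    proof -
      have "(\<Sum>i<k. t i * zstat p n (coord_vec n X i)) = (\<Sum>j<n. Y (X j) / sqrt (real n))"
        unfolding zstat_def coord_vec_def Y_def sum_divide_distrib sum_distrib_left
        by (subst sum.swap) (simp add: sum_distrib_left)
      then show ?thesis by (simp add: cis_sum)
    qed
    then show "measure_pmf.expectation \<nu> (\<lambda>x. cis (Y x / sqrt (real n))) ^ n =
      measure_pmf.expectation (power_dist \<nu> n) (\<lambda>X. cis (\<Sum>i<k. t i * zstat p n (coord_vec n X i)))"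
      using expectation_prod_Pi_pmf_finite[where A = "{..<n}" and q = "\<lambda>_. \<nu>" and d = undefined
          and h = "\<lambda>_ y. cis (Y y / sqrt (real n))"] fin
      by (simp add: power_dist_def)
  qed
  finally show ?thesis .
qed

section \<open>Amplified cosines and their limiting moments\<close>

definition wt :: "int \<Rightarrow> real" where
  "wt e = (if e = 0 then - 1 else 1 / 2)"

text \<open>Under a centred Gaussian of variance \<open>v\<close> the mean of
  \<open>cos (r * z)\<close> is \<open>exp (- v * r\<^sup>2 / 2)\<close>. The amplified cosine
  therefore has Gaussian mean 1, which is subtracted.\<close>

definition bump :: "real \<Rightarrow> real \<Rightarrow> real \<Rightarrow> real" where
  "bump v r z = exp (v * r\<^sup>2 / 2) * cos (r * z) - 1"

text \<open>
  \<^const>\<open>wt\<close> has total mass 0, which is what makes the Gaussian mean of \<^const>\<open>bump\<close> vanish.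
\<close>

lemma bump_cis:
  "complex_of_real (bump v r z) =
    (\<Sum>e\<in>{-1, 0, 1}. of_real (wt e * exp (v * (of_int e * r)\<^sup>2 / 2)) * cis (of_int e * r * z))"
  by (simp add: bump_def wt_def complex_eq_iff)

text \<open>
  The value of \<open>E (\<Prod>i<k. bump v (r i) (Z i))\<close> for a centred Gaussian vector \<open>Z\<close> with covariances \<open>C\<close> and
  variances \<open>v\<close>; the factors \<open>exp (v r\<^sup>2 / 2)\<close> cancel the diagonal of \<open>C\<close>.
\<close>

definition gauss_moment :: "nat \<Rightarrow> (nat \<Rightarrow> nat \<Rightarrow> real) \<Rightarrow> (nat \<Rightarrow> real) \<Rightarrow> real" where
  "gauss_moment k C r = (\<Sum>e\<in>{..<k} \<rightarrow>\<^sub>E {-1, 0, 1}. (\<Prod>i<k. wt (e i)) *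
     exp (- (\<Sum>i<k. \<Sum>j\<in>{..<k} - {i}. C i j * (of_int (e i) * r i) * (of_int (e j) * r j)) / 2))"

text \<open>The product of bumps is a finite trigonometric polynomial in the normalised sums, so the
  limit can be taken term by term.\<close>

lemma tendsto_power_dist_bump:
  assumes \<nu>: "\<nu> \<in> even_dists p k" and p: "0 \<le> p" "p \<le> 1"
  shows "(\<lambda>n. measure_pmf.expectation (power_dist \<nu> n)
      (\<lambda>X. \<Prod>i<k. bump (p * (1 - p)) (r i) (zstat p n (coord_vec n X i)))) \<longlonglongrightarrow>
    gauss_moment k (covar p \<nu>) r"
proof -
  define v where "v = p * (1 - p)"
  have v: "covar p \<nu> i i = v" if "i < k" for i
    using mean_even_dists[OF \<nu> that p, of "\<lambda>b. (of_bool b - p) * (of_bool b - p)"]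
    by (simp add: covar_def v_def algebra_simps)
  note fin = finite_even_dists[OF \<nu>]
  note [simp] = integrable_measure_pmf_finite[OF finite_power_dist[OF fin]]
  define I where "I = {..<k} \<rightarrow>\<^sub>E {-1, 0, 1 :: int}"
  have finI: "finite I" by (simp add: I_def finite_PiE)
  define c where "c = (\<lambda>e. \<Prod>i<k. wt (e i) * exp (v * (of_int (e i) * r i)\<^sup>2 / 2))"
  define t where "t = (\<lambda>e i. of_int (e i) * r i :: real)"
  have prod_eq: "complex_of_real (\<Prod>i<k. bump v (r i) (z i)) =
    (\<Sum>e\<in>I. of_real (c e) * cis (\<Sum>i<k. t e i * z i))" for z
    unfolding of_real_prod bump_cis I_def c_def t_def
    by (subst prod_sum_PiE) (simp_all add: prod.distrib cis_sum)
  have "(\<lambda>n. complex_of_real (measure_pmf.expectation (power_dist \<nu> n)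
      (\<lambda>X. \<Prod>i<k. bump v (r i) (zstat p n (coord_vec n X i))))) =
    (\<lambda>n. \<Sum>e\<in>I. of_real (c e) * measure_pmf.expectation (power_dist \<nu> n)
      (\<lambda>X. cis (\<Sum>i<k. t e i * zstat p n (coord_vec n X i))))"
    unfolding integral_complex_of_real[symmetric] prod_eq by simp
  also have "\<dots> \<longlonglongrightarrow> (\<Sum>e\<in>I. of_real (c e) *
     of_real (exp (- (\<Sum>i<k. \<Sum>j<k. covar p \<nu> i j * t e i * t e j) / 2)))"
    by (intro tendsto_intros tendsto_power_dist_cis \<nu> p)
  also have "(\<Sum>e\<in>I. complex_of_real (c e) *
     of_real (exp (- (\<Sum>i<k. \<Sum>j<k. covar p \<nu> i j * t e i * t e j) / 2))) =
     of_real (gauss_moment k (covar p \<nu>) r)"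
  proof -
    have "c e * exp (- (\<Sum>i<k. \<Sum>j<k. covar p \<nu> i j * t e i * t e j) / 2) = (\<Prod>i<k. wt (e i)) *
     exp (- (\<Sum>i<k. \<Sum>j\<in>{..<k} - {i}. covar p \<nu> i j * t e i * t e j) / 2)" for e
    proof -
      \<comment> \<open>\<open>2 * U\<close> is the diagonal part of the covariance form. The
        coefficient contributes \<open>exp U\<close> and the limit \<open>exp (- U)\<close>, so only
        the off-diagonal part \<open>W\<close> survives.\<close>
      define U W where "U = (\<Sum>i<k. v * (t e i)\<^sup>2 / 2)"
        and "W = (\<Sum>i<k. \<Sum>j\<in>{..<k} - {i}. covar p \<nu> i j * t e i * t e j)"
      have c: "c e = (\<Prod>i<k. wt (e i)) * exp U"
        by (simp add: c_def U_def t_def prod.distrib exp_sum)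
      have "(\<Sum>i<k. \<Sum>j<k. covar p \<nu> i j * t e i * t e j) =
        (\<Sum>i<k. v * (t e i)\<^sup>2 + (\<Sum>j\<in>{..<k} - {i}. covar p \<nu> i j * t e i * t e j))"
        by (intro sum.cong refl, subst sum.remove) (auto simp: v power2_eq_square)
      also have "\<dots> = 2 * U + W"
        by (simp add: U_def W_def sum.distrib sum_distrib_left)
      finally have "exp (- (\<Sum>i<k. \<Sum>j<k. covar p \<nu> i j * t e i * t e j) / 2) = exp (- U) * exp (- W / 2)"
        by (simp add: field_simps flip: exp_add)
      then show ?thesis
        unfolding W_def[symmetric] c by (simp add: exp_minus)
    qed
    then show ?thesis
      unfolding gauss_moment_def by (simp add: I_def t_def flip: of_real_mult of_real_sum)
  qed
  finally show ?thesis unfolding tendsto_of_real_iff v_def .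
qed


section \<open>Nonvanishing of the limiting moment\<close>

text \<open>Polarisation: inclusion--exclusion over the range of \<open>\<tau>\<close> isolates the bijections.\<close>

lemma sum_PiE_nonzero_if_sum_inj_nonzero:
  fixes P :: "(nat \<Rightarrow> nat) \<Rightarrow> 'b :: ab_group_add"
  assumes "(\<Sum>\<tau> | \<tau> \<in> {..<k} \<rightarrow>\<^sub>E {..<k} \<and> inj_on \<tau> {..<k}. P \<tau>) \<noteq> 0"
  obtains I where "I \<subseteq> {..<k}" "(\<Sum>\<tau>\<in>{..<k} \<rightarrow>\<^sub>E I. P \<tau>) \<noteq> 0"
proof (rule ccontr)
  assume "\<not> thesis"
  with that have zero: "(\<Sum>\<tau>\<in>{..<k} \<rightarrow>\<^sub>E I. P \<tau>) = 0" if "I \<subseteq> {..<k}" for I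
    using \<open>I \<subseteq> {..<k}\<close> by blast
  \<comment> \<open>\<open>f U\<close> collects the maps with image exactly \<open>U\<close>. The
    sum over all maps into \<open>U\<close> is the sum of \<open>f V\<close> over the subsets
    \<open>V\<close>, so induction on the cardinality makes every \<open>f U\<close> vanish.\<close>
  define f where "f = (\<lambda>U. \<Sum>\<tau> | \<tau> \<in> {..<k} \<rightarrow>\<^sub>E {..<k} \<and> \<tau> ` {..<k} = U. P \<tau>)"
  have "f U = 0" if "U \<subseteq> {..<k}" for U
    using that
  proof (induction "card U" arbitrary: U rule: less_induct)
    case less
    have fin: "finite U" using less.prems finite_subset by blast
    have "0 = (\<Sum>\<tau>\<in>{..<k} \<rightarrow>\<^sub>E U. P \<tau>)"
      using zero less.prems by simp
    also have "\<dots> = (\<Sum>V\<in>Pow U. \<Sum>\<tau> | \<tau> \<in> {..<k} \<rightarrow>\<^sub>E U \<and> \<tau> ` {..<k} = V. P \<tau>)"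
      by (rule sum.group[symmetric]) (auto simp: fin finite_PiE)
    also have "\<dots> = (\<Sum>V\<in>Pow U. f V)"
    proof (rule sum.cong)
      fix V assume "V \<in> Pow U"
      then have "{\<tau>. \<tau> \<in> {..<k} \<rightarrow>\<^sub>E U \<and> \<tau> ` {..<k} = V} = {\<tau>. \<tau> \<in> {..<k} \<rightarrow>\<^sub>E {..<k} \<and> \<tau> ` {..<k} = V}"
        using less.prems unfolding PiE_def by blast
      then show "(\<Sum>\<tau> | \<tau> \<in> {..<k} \<rightarrow>\<^sub>E U \<and> \<tau> ` {..<k} = V. P \<tau>) = f V"
        by (simp add: f_def)
    qed simp
    also have "\<dots> = f U + (\<Sum>V\<in>Pow U - {U}. f V)"
      by (rule sum.remove) (auto simp: fin)
    also have "(\<Sum>V\<in>Pow U - {U}. f V) = 0"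
    proof (intro sum.neutral ballI)
      fix V assume "V \<in> Pow U - {U}"
      then have "V \<subset> U" by auto
      then show "f V = 0"
        using less.prems by (intro less.hyps psubset_card_mono fin) auto
    qed
    finally show ?case by simp
  qed
  \<comment> \<open>A self-map of a finite set is injective iff it is surjective, so the sum in the
    assumption is \<open>f {..<k}\<close>.\<close>
  moreover have "{\<tau>. \<tau> \<in> {..<k} \<rightarrow>\<^sub>E {..<k} \<and> inj_on \<tau> {..<k}} =
      {\<tau>. \<tau> \<in> {..<k} \<rightarrow>\<^sub>E {..<k} \<and> \<tau> ` {..<k} = {..<k}}"
  proof -
    have "inj_on \<tau> {..<k} \<longleftrightarrow> \<tau> ` {..<k} = {..<k}" if "\<tau> \<in> {..<k} \<rightarrow>\<^sub>E {..<k}" for \<tau>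
    proof
      show "\<tau> ` {..<k} = {..<k}" if "inj_on \<tau> {..<k}"
        using that \<open>\<tau> \<in> _\<close> by (intro endo_inj_surj) auto
      show "inj_on \<tau> {..<k}" if "\<tau> ` {..<k} = {..<k}"
        using that by (intro finite_surj_inj) auto
    qed
    then show ?thesis by blast
  qed
  ultimately show False using assms unfolding f_def by auto
qed

section \<open>Minima of the off-diagonal form\<close>

definition offdiag_form :: "nat \<Rightarrow> (nat \<Rightarrow> nat \<Rightarrow> real) \<Rightarrow> (nat \<Rightarrow> real) \<Rightarrow> real" where
  "offdiag_form k C u = (\<Sum>i<k. \<Sum>j\<in>{..<k} - {i}. C i j * u i * u j)"

text \<open>No monomial contains the square of a coordinate, so the form is affine in each of them.
  By symmetry row \<open>i\<close> and column \<open>i\<close> contribute equally, whence the factor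
  2.\<close>

lemma offdiag_form_update:
  assumes sym: "\<And>i j. C i j = C j i" and i: "i < k" and "u i = 0"
  shows "offdiag_form k C (u(i := x)) = offdiag_form k C u + 2 * x * (\<Sum>j\<in>{..<k} - {i}. C i j * u j)"
proof -
  let ?L = "\<Sum>j\<in>{..<k} - {i}. C i j * u j"
  \<comment> \<open>Row \<open>i\<close> is split off first, then column \<open>i\<close>; the
    remaining double sum does not involve coordinate \<open>i\<close>.\<close>
  have split: "offdiag_form k C w = (\<Sum>j\<in>{..<k} - {i}. C i j * w i * w j) +
      (\<Sum>a\<in>{..<k} - {i}. C a i * w a * w i + (\<Sum>j\<in>{..<k} - {a} - {i}. C a j * w a * w j))" for w
    unfolding offdiag_form_def using i
    by (subst sum.remove[of _ i]) (auto intro!: sum.cong sum.remove)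
  have "offdiag_form k C (u(i := x)) = x * ?L + (x * ?L +
      (\<Sum>a\<in>{..<k} - {i}. \<Sum>j\<in>{..<k} - {a} - {i}. C a j * u a * u j))"
    unfolding split[of "u(i := x)"] sum.distrib
    by (intro arg_cong2[of _ _ _ _ "(+)"])
       (auto simp: sum_distrib_left sym[of _ i] mult_ac intro!: sum.cong)
  moreover have "offdiag_form k C u = (\<Sum>a\<in>{..<k} - {i}. \<Sum>j\<in>{..<k} - {a} - {i}. C a j * u a * u j)"
    unfolding split[of u] using \<open>u i = 0\<close> by simp
  ultimately show ?thesis by simp
qed

text \<open>Each of the finitely many sums is a nonzero polynomial in \<open>b\<close>, so all but finitely many \<open>b\<close> work.\<close>

lemma exists_generic_scale:
  fixes C :: "nat \<Rightarrow> nat \<Rightarrow> real"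
  obtains b :: real where "b > 0"
    "\<And>i \<tau> e j. \<lbrakk>i < k; \<tau> \<in> {..<k} \<rightarrow>\<^sub>E {..<k}; inj_on \<tau> {..<k}; e \<in> {..<k} \<rightarrow>\<^sub>E {-1, 0, 1 :: int};
      j < k; j \<noteq> i; C i j \<noteq> 0; e j \<noteq> 0\<rbrakk> \<Longrightarrow>
      (\<Sum>j\<in>{..<k} - {i}. C i j * (of_int (e j) * b ^ \<tau> j)) \<noteq> 0"
proof -
  define P where "P = (\<lambda>(i, \<tau>, e). \<Sum>j\<in>{..<k} - {i}. monom (C i j * of_int (e j)) (\<tau> j))"
  have poly_P: "poly (P (i, \<tau>, e)) b = (\<Sum>j\<in>{..<k} - {i}. C i j * (of_int (e j) * b ^ \<tau> j))" for i \<tau> e b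
    by (simp add: P_def poly_sum poly_monom mult_ac)
  define F where "F = {..<k} \<times> {\<tau> \<in> {..<k} \<rightarrow>\<^sub>E {..<k}. inj_on \<tau> {..<k}} \<times> ({..<k} \<rightarrow>\<^sub>E {-1, 0, 1 :: int})"
  have "finite F" by (auto simp: F_def finite_PiE)
  then have "finite (\<Union>f\<in>{f\<in>F. P f \<noteq> 0}. {b. poly (P f) b = 0})"
    by (auto intro: poly_roots_finite)
  then obtain b :: real where b: "b > 0" "b \<notin> (\<Union>f\<in>{f\<in>F. P f \<noteq> 0}. {b. poly (P f) b = 0})"
    using Diff_infinite_finite[OF _ infinite_Ioi[of "0 :: real"], THEN infinite_imp_nonempty]
    by blast
  show thesis
  proof
    fix i \<tau> e j
    assume *: "i < k" "\<tau> \<in> {..<k} \<rightarrow>\<^sub>E {..<k}" "inj_on \<tau> {..<k}" "e \<in> {..<k} \<rightarrow>\<^sub>E {-1, 0, 1 :: int}"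
      "j < k" "j \<noteq> i" "C i j \<noteq> 0" "e j \<noteq> 0"
    \<comment> \<open>Injectivity of \<open>\<tau>\<close> makes the exponents distinct, so nothing
      cancels and only \<open>j\<close> contributes at exponent \<open>\<tau> j\<close>.\<close>
    have "coeff (P (i, \<tau>, e)) (\<tau> j) = (\<Sum>j'\<in>{..<k} - {i}. if j' = j then C i j * of_int (e j) else 0)"
    proof -
      have "\<tau> j' = \<tau> j \<longleftrightarrow> j' = j" if "j' < k" for j'
        using inj_on_eq_iff[OF *(3), of j' j] that *(5) by simp
      then show ?thesis
        unfolding P_def by (simp add: coeff_sum cong: if_cong)
    qed
    also have "\<dots> = C i j * of_int (e j)" using * by simp
    also have "\<dots> \<noteq> 0" using *(7,8) by simp
    finally have "P (i, \<tau>, e) \<noteq> 0" by (metis coeff_0)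
    moreover have "(i, \<tau>, e) \<in> F" using * by (simp add: F_def)
    ultimately show "(\<Sum>j\<in>{..<k} - {i}. C i j * (of_int (e j) * b ^ \<tau> j)) \<noteq> 0"
      using b(2) unfolding poly_P[symmetric] by blast
  qed (fact b)
qed

text \<open>
  Along a zero coordinate \<open>i\<close> the form is linear, so it can be decreased if its slope there is nonzero. If the
  slope is 0, then all neighbours of \<open>i\<close> are zero coordinates, and switching one of them on first makes it nonzero.
\<close>

lemma offdiag_form_decrease:
  fixes e :: "nat \<Rightarrow> int"
  assumes sym: "\<And>i j. C i j = C j i"
    and nbr: "\<And>i. i < k \<Longrightarrow> \<exists>j<k. j \<noteq> i \<and> C i j \<noteq> 0"
    and r: "\<And>i. r i > 0"
    and generic: "\<And>e i j. \<lbrakk>e \<in> {..<k} \<rightarrow>\<^sub>E {-1, 0, 1 :: int}; i < k; j < k; j \<noteq> i; C i j \<noteq> 0; e j \<noteq> 0\<rbrakk> \<Longrightarrow>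
      (\<Sum>j\<in>{..<k} - {i}. C i j * (of_int (e j) * r j)) \<noteq> 0"
    and e: "e \<in> {..<k} \<rightarrow>\<^sub>E {-1, 0, 1}" and i: "i < k" "e i = 0"
  shows "\<exists>e'\<in>{..<k} \<rightarrow>\<^sub>E {-1, 0, 1}.
    offdiag_form k C (\<lambda>i. of_int (e' i) * r i) < offdiag_form k C (\<lambda>i. of_int (e i) * r i)"
proof -
  define Q where "Q = (\<lambda>e :: nat \<Rightarrow> int. offdiag_form k C (\<lambda>i. of_int (e i) * r i))"
  define L where "L = (\<lambda>(e :: nat \<Rightarrow> int) i. \<Sum>j\<in>{..<k} - {i}. C i j * (of_int (e j) * r j))"
  have upd: "Q (e(i := s)) = Q e + 2 * (of_int s * r i) * L e i" if "i < k" "e i = 0" for e i s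
  proof -
    have "(\<lambda>j. of_int ((e(i := s)) j) * r j) = (\<lambda>j. of_int (e j) * r j)(i := of_int s * r i)"
      by auto
    then show ?thesis
      using offdiag_form_update[where C = C and u = "\<lambda>i. of_int (e i) * r i" and x = "of_int s * r i",
          OF sym that(1)] that(2)
      unfolding Q_def L_def by simp
  qed
  have mem: "e(i := s) \<in> {..<k} \<rightarrow>\<^sub>E {-1, 0, 1}"
    if "e \<in> {..<k} \<rightarrow>\<^sub>E {-1, 0, 1 :: int}" "i < k" "s \<in> {-1, 0, 1}" for e i s
    using that by (auto simp: PiE_iff extensional_def)
  have step: "\<exists>e'\<in>{..<k} \<rightarrow>\<^sub>E {-1, 0, 1}. Q e' < Q e"
    if "e \<in> {..<k} \<rightarrow>\<^sub>E {-1, 0, 1}" "i < k" "e i = 0" "L e i \<noteq> 0" for e i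
  proof -
    have "Q (e(i := if L e i > 0 then -1 else 1)) < Q e"
    proof (cases "L e i > 0")
      case True
      then show ?thesis using that r[of i] by (simp add: upd)
    next
      case False
      then have "r i * L e i < 0" using that r[of i] by (intro mult_pos_neg) auto
      then show ?thesis using False that by (simp add: upd)
    qed
    moreover have "e(i := if L e i > 0 then -1 else 1) \<in> {..<k} \<rightarrow>\<^sub>E {-1, 0, 1}"
      using that(1,2) by (rule mem) simp
    ultimately show ?thesis by blast
  qed
  have "\<exists>e'\<in>{..<k} \<rightarrow>\<^sub>E {-1, 0, 1}. Q e' < Q e"
  proof (cases "L e i = 0")
    case False
    then show ?thesis using step e i by blast
  next
    case True
    obtain j where j: "j < k" "j \<noteq> i" "C i j \<noteq> 0" using nbr i by blast
    with generic[OF e i(1) j] True have ej: "e j = 0" by (auto simp: L_def)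
    \<comment> \<open>The sign opposes the slope at \<open>j\<close>, so this switch does not
      increase the form. That is enough, because the later switch at \<open>i\<close> decreases it
      strictly.\<close>
    define s :: int where "s = (if L e j > 0 then -1 else 1)"
    define e2 where "e2 = e(j := s)"
    have "Q e2 \<le> Q e"
    proof (cases "L e j > 0")
      case True
      then show ?thesis using j ej r[of j] by (simp add: upd e2_def s_def)
    next
      case False
      then have "r j * L e j \<le> 0" using r[of j] by (intro mult_nonneg_nonpos) auto
      then show ?thesis using False j ej by (simp add: upd e2_def s_def)
    qed
    moreover have e2: "e2 \<in> {..<k} \<rightarrow>\<^sub>E {-1, 0, 1}"
      unfolding e2_def using e j by (intro mem) (auto simp: s_def)
    moreover have "L e2 i \<noteq> 0"
      unfolding L_def by (rule generic[OF e2 i(1) j]) (simp add: e2_def s_def)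
    moreover have "e2 i = 0" using i j by (simp add: e2_def)
    ultimately show ?thesis using step[of e2 i] i by (meson less_le_trans)
  qed
  then show ?thesis by (simp add: Q_def)
qed


text \<open>After division by \<open>exp (s * M)\<close>, where \<open>M\<close> is the largest
  exponent, the sum tends to the total weight of the maximisers as \<open>s\<close> grows, and this
  is positive.\<close>

lemma exists_sum_exp_nonzero:
  fixes W E :: "'a \<Rightarrow> real"
  assumes "finite A" "A \<noteq> {}"
    and top: "\<And>a. a \<in> A \<Longrightarrow> (\<And>b. b \<in> A \<Longrightarrow> E b \<le> E a) \<Longrightarrow> W a > 0"
  shows "\<exists>s\<ge>0. (\<Sum>a\<in>A. W a * exp (s * E a)) \<noteq> 0"
proof -
  define M where "M = Max (E ` A)"
  have M: "E a \<le> M" if "a \<in> A" for a using assms that by (simp add: M_def)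
  have "M \<in> E ` A" unfolding M_def using assms by (intro Max_in) auto
  then obtain a where a: "a \<in> A" "E a = M" by blast
  have lim: "((\<lambda>s. W b * exp (s * (E b - M))) \<longlongrightarrow> (if E b = M then W b else 0)) at_top"
    if "b \<in> A" for b
  proof (cases "E b = M")
    case False
    with M[OF that] have "E b - M < 0" by simp
    then have "((\<lambda>s. W b * exp (s * (E b - M))) \<longlongrightarrow> 0) at_top"
      by real_asymp
    then show ?thesis using False by simp
  qed simp
  have "((\<lambda>s. \<Sum>b\<in>A. W b * exp (s * (E b - M))) \<longlongrightarrow> (\<Sum>b\<in>A. if E b = M then W b else 0)) at_top"
    by (intro tendsto_sum lim)
  moreover have "(\<Sum>b\<in>A. if E b = M then W b else 0) > 0"
  proof (rule sum_pos2[OF \<open>finite A\<close> a(1)])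
    show "(if E a = M then W a else 0) > 0" using a M top[of a] by auto
    show "(if E b = M then W b else 0) \<ge> 0" if "b \<in> A" for b
      using that M top[of b] by (auto intro: less_imp_le)
  qed
  ultimately have "\<forall>\<^sub>F s in at_top. (\<Sum>b\<in>A. W b * exp (s * (E b - M))) > 0"
    by (rule order_tendstoD)
  then have "\<forall>\<^sub>F s in at_top. s \<ge> 0 \<and> (\<Sum>b\<in>A. W b * exp (s * (E b - M))) > 0"
    using eventually_ge_at_top[of 0] by eventually_elim auto
  then obtain s :: real where s: "s \<ge> 0" "(\<Sum>b\<in>A. W b * exp (s * (E b - M))) > 0"
    using eventually_happens'[OF trivial_limit_at_top_linorder] by blast
  have "(\<Sum>b\<in>A. W b * exp (s * (E b - M))) = (\<Sum>b\<in>A. W b * exp (s * E b)) * exp (- s * M)"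
    unfolding sum_distrib_right by (simp add: algebra_simps flip: exp_add)
  then show ?thesis using s by (intro exI[of _ s]) auto
qed

text \<open>Up to normalisation, the sum over \<open>\<tau>\<close> is the limiting correlation when
  the sum of the bumps with frequencies \<open>r i\<close>, \<open>i\<close> in \<open>I\<close>, is
  placed in all \<open>k\<close> slots.\<close>

lemma exists_gauss_moment_nonzero:
  assumes sym: "\<And>i j. C i j = C j i"
    and nbr: "\<And>i. i < k \<Longrightarrow> \<exists>j<k. j \<noteq> i \<and> C i j \<noteq> 0"
  obtains I r where "I \<subseteq> {..<k}" "(\<Sum>\<tau>\<in>{..<k} \<rightarrow>\<^sub>E I. gauss_moment k C (r \<circ> \<tau>)) \<noteq> 0"
proof -
  obtain b :: real where b: "b > 0" and generic:
    "\<And>i \<tau> e j. \<lbrakk>i < k; \<tau> \<in> {..<k} \<rightarrow>\<^sub>E {..<k}; inj_on \<tau> {..<k}; e \<in> {..<k} \<rightarrow>\<^sub>E {-1, 0, 1 :: int};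
      j < k; j \<noteq> i; C i j \<noteq> 0; e j \<noteq> 0\<rbrakk> \<Longrightarrow>
      (\<Sum>j\<in>{..<k} - {i}. C i j * (of_int (e j) * b ^ \<tau> j)) \<noteq> 0"
    by (rule exists_generic_scale[of k C]; rule that; assumption)
  \<comment> \<open>Polarisation only isolates the sum over all injective \<open>\<tau>\<close>, so
    dominant terms are sought among all pairs \<open>(\<tau>, e)\<close> at once. As they all have
    positive weight, different \<open>\<tau>\<close> cannot cancel each other.\<close>
  define T where "T = {\<tau>. \<tau> \<in> {..<k} \<rightarrow>\<^sub>E {..<k} \<and> inj_on \<tau> {..<k}}"
  define J where "J = {..<k} \<rightarrow>\<^sub>E {-1, 0, 1 :: int}"
  define W where "W = (\<lambda>(\<tau> :: nat \<Rightarrow> nat, e :: nat \<Rightarrow> int). \<Prod>i<k. wt (e i))"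
  define E where "E = (\<lambda>(\<tau> :: nat \<Rightarrow> nat, e :: nat \<Rightarrow> int). - offdiag_form k C (\<lambda>i. of_int (e i) * b ^ \<tau> i) / 2)"
  have fin: "finite T" "finite J" by (auto simp: T_def J_def finite_PiE)
  have "(\<lambda>i\<in>{..<k}. i) \<in> T" "(\<lambda>i\<in>{..<k}. 0) \<in> J" by (auto simp: T_def J_def inj_on_def)
  then have ne: "T \<times> J \<noteq> {}" by blast
  have "\<exists>s\<ge>0. (\<Sum>a\<in>T \<times> J. W a * exp (s * E a)) \<noteq> 0"
  proof (rule exists_sum_exp_nonzero)
    fix a assume "a \<in> T \<times> J" and max: "\<And>a'. a' \<in> T \<times> J \<Longrightarrow> E a' \<le> E a"
    then obtain \<tau> e where a: "a = (\<tau>, e)" "\<tau> \<in> T" "e \<in> J" by blast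
    \<comment> \<open>A zero coordinate would allow the form to be decreased for the same
      \<open>\<tau>\<close>, against the maximality of \<open>E\<close> at
      \<open>(\<tau>, e)\<close>.\<close>
    have "e i \<noteq> 0" if "i < k" for i
    proof
      assume "e i = 0"
      have "\<exists>e'\<in>J. offdiag_form k C (\<lambda>i. of_int (e' i) * b ^ \<tau> i) < offdiag_form k C (\<lambda>i. of_int (e i) * b ^ \<tau> i)"
        unfolding J_def
      proof (rule offdiag_form_decrease[OF sym nbr _ generic])
        show "b ^ \<tau> i > 0" for i using b by simp
        show "\<tau> \<in> {..<k} \<rightarrow>\<^sub>E {..<k}" "inj_on \<tau> {..<k}" using a by (simp_all add: T_def)
        show "e \<in> {..<k} \<rightarrow>\<^sub>E {-1, 0, 1}" using a by (simp add: J_def)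
      qed (use \<open>e i = 0\<close> that in auto)
      then obtain e' where "e' \<in> J" and less:
        "offdiag_form k C (\<lambda>i. of_int (e' i) * b ^ \<tau> i) < offdiag_form k C (\<lambda>i. of_int (e i) * b ^ \<tau> i)"
        by blast
      from less have "E (\<tau>, e') > E (\<tau>, e)" unfolding E_def by simp
      moreover have "E (\<tau>, e') \<le> E (\<tau>, e)"
        using max[of "(\<tau>, e')"] a \<open>e' \<in> J\<close> by simp
      ultimately show False by simp
    qed
    then show "W a > 0" unfolding a W_def wt_def by (auto intro!: prod_pos)
  qed (use fin ne in auto)
  then obtain s where s: "s \<ge> 0" "(\<Sum>a\<in>T \<times> J. W a * exp (s * E a)) \<noteq> 0" by blast
  \<comment> \<open>The form is quadratic, so the factor \<open>sqrt s\<close> in the frequencies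
    multiplies it by \<open>s\<close>.\<close>
  define r where "r = (\<lambda>i. sqrt s * b ^ i)"
  have "gauss_moment k C (r \<circ> \<tau>) = (\<Sum>e\<in>J. W (\<tau>, e) * exp (s * E (\<tau>, e)))" for \<tau>
  proof -
    have "(\<Sum>i<k. \<Sum>j\<in>{..<k} - {i}. C i j * (of_int (e i) * (r \<circ> \<tau>) i) * (of_int (e j) * (r \<circ> \<tau>) j)) =
      s * offdiag_form k C (\<lambda>i. of_int (e i) * b ^ \<tau> i)" for e :: "nat \<Rightarrow> int"
    proof -
      have eq: "c * (x * (r \<circ> \<tau>) i) * (y * (r \<circ> \<tau>) j) = s * (c * (x * b ^ \<tau> i) * (y * b ^ \<tau> j))" for c x y i j
      proof -
        have "c * (x * (r \<circ> \<tau>) i) * (y * (r \<circ> \<tau>) j) = (sqrt s * sqrt s) * (c * (x * b ^ \<tau> i) * (y * b ^ \<tau> j))"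
          unfolding r_def o_def by (simp only: mult_ac)
        then show ?thesis using s(1) by simp
      qed
      show ?thesis unfolding offdiag_form_def sum_distrib_left by (intro sum.cong refl eq)
    qed
    then show ?thesis by (simp add: gauss_moment_def J_def W_def E_def)
  qed
  then have "(\<Sum>\<tau>\<in>T. gauss_moment k C (r \<circ> \<tau>)) \<noteq> 0"
    using s(2) by (simp add: sum.cartesian_product)
  then show thesis
    unfolding T_def by (rule sum_PiE_nonzero_if_sum_inj_nonzero) (rule that)
qed

section \<open>Correlation with characters\<close>

text \<open>Factoring the difference of powers leaves a geometric series. The bound does not depend
  on \<open>m\<close>, which later makes the character estimates uniform in
  \<open>card S\<close>.\<close>

lemma norm_power_diff_le:
  fixes z w :: complex
  assumes "norm z \<le> c" "norm w \<le> c" "0 \<le> c" "c < 1"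
  shows "norm (z ^ m - w ^ m) \<le> norm (z - w) / (1 - c)"
proof -
  have "norm (z ^ m - w ^ m) = norm (z - w) * norm (\<Sum>i<m. z ^ i * w ^ (m - Suc i))"
    by (simp add: power_diff_sumr2 norm_mult mult.commute)
  also have "\<dots> \<le> norm (z - w) * (1 / (1 - c))"
  proof (intro mult_left_mono)
    have "norm (\<Sum>i<m. z ^ i * w ^ (m - Suc i)) \<le> (\<Sum>i<m. c ^ i)"
    proof (rule order_trans[OF norm_sum sum_mono])
      fix i
      have "norm z ^ i * norm w ^ (m - Suc i) \<le> c ^ i * 1"
        using assms by (intro mult_mono power_mono power_le_one) auto
      then show "norm (z ^ i * w ^ (m - Suc i)) \<le> c ^ i"
        by (simp add: norm_mult norm_power)
    qed
    also have "\<dots> \<le> 1 / (1 - c)"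
      using assms by (simp add: sum_gp_strict divide_right_mono)
    finally show "norm (\<Sum>i<m. z ^ i * w ^ (m - Suc i)) \<le> 1 / (1 - c)" .
  qed auto
  finally show ?thesis by simp
qed

text \<open>Character and exponential both factor over the coordinates, and a factor depends only on
  whether its coordinate lies in \<open>S\<close>. The empty \<open>S\<close> yields the
  characteristic function itself.\<close>

lemma chi_cis_expectation:
  assumes "S \<subseteq> {..<n}"
  shows "measure_pmf.expectation (biased_cube p n) (\<lambda>x. of_real (chi S x) * cis (t * zstat p n x)) =
    measure_pmf.expectation (bernoulli_pmf p) (\<lambda>b. (-1) ^ of_bool b * cis (t * (of_bool b - p) / sqrt (real n))) ^ card S *
    measure_pmf.expectation (bernoulli_pmf p) (\<lambda>b. cis (t * (of_bool b - p) / sqrt (real n))) ^ (n - card S)"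
    (is "_ = ?A ^ _ * ?B ^ _")
proof -
  define g where "g = (\<lambda>j b. (if j \<in> S then (-1) ^ of_bool b else 1) * cis (t * (of_bool b - p) / sqrt (real n)))"
  have fin: "finite S" using assms finite_subset by blast
  have "of_real (chi S x) * cis (t * zstat p n x) = (\<Prod>j<n. g j (x j))" for x
  proof -
    have "t * zstat p n x = (\<Sum>j<n. t * (of_bool (x j) - p) / sqrt (real n))"
      by (simp add: zstat_def sum_distrib_left sum_divide_distrib)
    moreover have "complex_of_real (chi S x) = (\<Prod>j<n. if j \<in> S then (-1) ^ of_bool (x j) else 1)"
      unfolding chi_def using assms
      by (simp add: inf.absorb2 flip: prod.inter_restrict)
    ultimately show ?thesis by (simp add: g_def cis_sum prod.distrib)
  qed
  then have "measure_pmf.expectation (biased_cube p n) (\<lambda>x. of_real (chi S x) * cis (t * zstat p n x)) =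
    (\<Prod>j<n. measure_pmf.expectation (bernoulli_pmf p) (g j))"
    unfolding biased_cube_def by (simp add: expectation_prod_Pi_pmf_finite)
  also have "\<dots> = (\<Prod>j<n. if j \<in> S then ?A else ?B)"
    by (intro prod.cong) (auto simp: g_def)
  also have "\<dots> = ?A ^ card S * ?B ^ card ({..<n} - S)"
    using assms by (simp add: prod.If_cases inf.absorb2 Diff_eq)
  also have "card ({..<n} - S) = n - card S"
    using assms fin by (simp add: card_Diff_subset)
  finally show ?thesis .
qed


lemma finite_biased_cube: "finite (set_pmf (biased_cube p n))"
  unfolding biased_cube_def by (rule finite_set_Pi_pmf) (auto intro: finite_subset[OF subset_UNIV])

lemma expectation_bernoulli_pmf:
  fixes f :: "bool \<Rightarrow> 'a :: {banach, second_countable_topology}"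
  assumes "0 \<le> p" "p \<le> 1"
  shows "measure_pmf.expectation (bernoulli_pmf p) f = p *\<^sub>R f True + (1 - p) *\<^sub>R f False"
  using assms by (subst integral_measure_pmf[of UNIV]) (auto simp: UNIV_bool)

text \<open>The factor \<open>A n\<close> of a coordinate in \<open>S\<close> tends to
  \<open>c\<close>, the mean of a one-bit character, and the factor \<open>B n\<close> of any other
  one tends to 1. Replacing \<open>A n\<close> by \<open>c * B n\<close> costs an error that is
  uniform in \<open>S\<close>, as \<open>c\<close> has modulus below 1; small and large orders are
  thus treated together.\<close>

lemma chi_cis_decouple:
  assumes "0 < p" "p < 1"
  shows "\<exists>\<epsilon>. \<epsilon> \<longlonglongrightarrow> 0 \<and> (\<forall>\<^sub>F n in sequentially. \<forall>S\<subseteq>{..<n}.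
    norm (measure_pmf.expectation (biased_cube p n) (\<lambda>x. of_real (chi S x) * cis (t * zstat p n x)) -
      of_real (1 - 2 * p) ^ card S * measure_pmf.expectation (biased_cube p n) (\<lambda>x. cis (t * zstat p n x))) \<le> \<epsilon> n)"
proof -
  define A where "A = (\<lambda>n. measure_pmf.expectation (bernoulli_pmf p)
    (\<lambda>b. (-1) ^ of_bool b * cis (t * (of_bool b - p) / sqrt (real n))))"
  define B where "B = (\<lambda>n. measure_pmf.expectation (bernoulli_pmf p)
    (\<lambda>b. cis (t * (of_bool b - p) / sqrt (real n))))"
  define c where "c = complex_of_real (1 - 2 * p)"
  \<comment> \<open>A number strictly between \<open>norm c\<close> and 1: it bounds
    \<open>c * B n\<close> always and \<open>A n\<close> eventually.\<close>
  define d where "d = (1 + norm c) / 2"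
  have c: "norm c < 1" using assms unfolding c_def norm_of_real by (simp add: abs_less_iff)
  then have d: "norm c \<le> d" "norm c < d" "0 \<le> d" "d < 1" by (auto simp: d_def)
  have cis_lim: "(\<lambda>n. cis (s / sqrt (real n))) \<longlonglongrightarrow> cis 0" for s
    by (intro tendsto_cis) real_asymp
  have A_eq: "A = (\<lambda>n. of_real p * - cis (t * (1 - p) / sqrt (real n)) + of_real (1 - p) * cis (- (t * p) / sqrt (real n)))"
    and B_eq: "B = (\<lambda>n. of_real p * cis (t * (1 - p) / sqrt (real n)) + of_real (1 - p) * cis (- (t * p) / sqrt (real n)))"
    using assms by (simp_all add: A_def B_def expectation_bernoulli_pmf scaleR_conv_of_real)
  have "A \<longlonglongrightarrow> of_real p * - 1 + of_real (1 - p) * 1"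
    unfolding A_eq using cis_lim[of "t * (1 - p)"] cis_lim[of "- (t * p)"]
    by (intro tendsto_intros) simp_all
  moreover have "of_real p * - 1 + of_real (1 - p) * 1 = c" by (simp add: c_def)
  ultimately have A: "A \<longlonglongrightarrow> c" by simp
  have "B \<longlonglongrightarrow> of_real p * 1 + of_real (1 - p) * 1"
    unfolding B_eq using cis_lim[of "t * (1 - p)"] cis_lim[of "- (t * p)"]
    by (intro tendsto_intros) simp_all
  then have B: "B \<longlonglongrightarrow> 1" by simp
  have B1: "norm (B n) \<le> 1" for n
    unfolding B_def by (rule order_trans[OF integral_norm_bound]) simp
  have "(\<lambda>n. norm (A n - c * B n) / (1 - d)) \<longlonglongrightarrow> norm (c - c * 1) / (1 - d)"
    using d by (intro tendsto_intros A B) auto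
  moreover have "\<forall>\<^sub>F n in sequentially. norm (A n) < d"
    using tendsto_norm[OF A] d(2) by (rule order_tendstoD)
  then have "\<forall>\<^sub>F n in sequentially. \<forall>S\<subseteq>{..<n}.
    norm (measure_pmf.expectation (biased_cube p n) (\<lambda>x. of_real (chi S x) * cis (t * zstat p n x)) -
      c ^ card S * measure_pmf.expectation (biased_cube p n) (\<lambda>x. cis (t * zstat p n x)))
      \<le> norm (A n - c * B n) / (1 - d)"
  proof eventually_elim
    case (elim n)
    show ?case
    proof (intro allI impI)
      fix S :: "nat set" assume S: "S \<subseteq> {..<n}"
      define m where "m = card S"
      have m: "m \<le> n" using card_mono[OF _ S] by (simp add: m_def)
      have EA: "measure_pmf.expectation (biased_cube p n) (\<lambda>x. of_real (chi S x) * cis (t * zstat p n x)) =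
          A n ^ m * B n ^ (n - m)"
        unfolding chi_cis_expectation[OF S] A_def B_def m_def ..
      have EB: "measure_pmf.expectation (biased_cube p n) (\<lambda>x. cis (t * zstat p n x)) = B n ^ n"
        using chi_cis_expectation[of "{}" n p t] by (simp add: chi_def B_def)
      have "A n ^ m * B n ^ (n - m) - c ^ m * B n ^ n = B n ^ (n - m) * (A n ^ m - (c * B n) ^ m)"
        using power_add[of "B n" "n - m" m] m by (simp add: algebra_simps)
      then have "norm (A n ^ m * B n ^ (n - m) - c ^ m * B n ^ n) =
          norm (B n) ^ (n - m) * norm (A n ^ m - (c * B n) ^ m)"
        by (simp only: norm_mult norm_power)
      also have "\<dots> \<le> 1 * norm (A n ^ m - (c * B n) ^ m)"
        by (intro mult_right_mono power_le_one B1) auto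
      also have "\<dots> \<le> norm (A n - c * B n) / (1 - d)"
        unfolding mult_1
      proof (rule norm_power_diff_le)
        have "norm (c * B n) \<le> norm c * 1" unfolding norm_mult by (intro mult_left_mono B1) simp
        then show "norm (c * B n) \<le> d" using d by simp
      qed (use d elim in auto)
      finally show "norm (measure_pmf.expectation (biased_cube p n) (\<lambda>x. of_real (chi S x) * cis (t * zstat p n x)) -
        c ^ card S * measure_pmf.expectation (biased_cube p n) (\<lambda>x. cis (t * zstat p n x)))
        \<le> norm (A n - c * B n) / (1 - d)"
        unfolding EA EB by (simp add: m_def)
    qed
  qed
  ultimately show ?thesis unfolding c_def by (intro exI conjI) auto
qed

lemma tendsto_biased_cube_cis:
  assumes "0 \<le> p" "p \<le> 1"
  shows "(\<lambda>n. measure_pmf.expectation (biased_cube p n) (\<lambda>x. cis (t * zstat p n x))) \<longlonglongrightarrow>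
    of_real (exp (- (p * (1 - p) * t\<^sup>2) / 2))"
proof -
  have "measure_pmf.expectation (biased_cube p n) (\<lambda>x. cis (t * zstat p n x)) =
      measure_pmf.expectation (bernoulli_pmf p) (\<lambda>b. cis (t * (of_bool b - p) / sqrt (real n))) ^ n" for n
    using chi_cis_expectation[of "{}" n p t] by (simp add: chi_def)
  moreover have "measure_pmf.expectation (bernoulli_pmf p) (\<lambda>b. (t * (of_bool b - p))\<^sup>2) = p * (1 - p) * t\<^sup>2"
    using assms by (simp add: power2_eq_square algebra_simps)
  moreover have "measure_pmf.expectation (bernoulli_pmf p) (\<lambda>b. t * (of_bool b - p)) = 0"
    using assms by (simp add: algebra_simps)
  ultimately show ?thesis
    using clt_cis[of "bernoulli_pmf p" "\<lambda>b. t * (of_bool b - p)"]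
    by (simp add: finite_subset[OF subset_UNIV])
qed

text \<open>Decoupling each exponential splits the correlation into small errors and
  \<open>c ^ card S\<close> times the mean of the bump. This mean tends to 0 and the power has
  modulus at most 1, so the bound is uniform in \<open>S\<close>.\<close>

lemma bump_chi_small:
  assumes p: "0 < p" "p < 1"
  shows "\<exists>\<epsilon>. \<epsilon> \<longlonglongrightarrow> 0 \<and> (\<forall>\<^sub>F n in sequentially. \<forall>S\<subseteq>{..<n}.
    \<bar>measure_pmf.expectation (biased_cube p n) (\<lambda>x. bump (p * (1 - p)) t (zstat p n x) * chi S x)\<bar> \<le> \<epsilon> n)"
proof -
  note [simp] = integrable_measure_pmf_finite[OF finite_biased_cube]
  define a where "a = (\<lambda>e :: int. wt e * exp (p * (1 - p) * (of_int e * t)\<^sup>2 / 2))"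
  define F where "F = (\<lambda>n e S. measure_pmf.expectation (biased_cube p n)
    (\<lambda>x. complex_of_real (chi S x) * cis (of_int e * t * zstat p n x)))"
  define G where "G = (\<lambda>n e. measure_pmf.expectation (biased_cube p n) (\<lambda>x. cis (of_int e * t * zstat p n x)))"
  define c where "c = complex_of_real (1 - 2 * p)"
  have c: "norm c \<le> 1" using p unfolding c_def norm_of_real by (simp add: abs_le_iff)
  let ?E = "{-1, 0, 1 :: int}"
  have "\<forall>e. \<exists>\<epsilon>. \<epsilon> \<longlonglongrightarrow> (0 :: real) \<and>
      (\<forall>\<^sub>F n in sequentially. \<forall>S\<subseteq>{..<n}. norm (F n e S - c ^ card S * G n e) \<le> \<epsilon> n)"
    unfolding F_def G_def c_def by (intro allI chi_cis_decouple p)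
  from choice[OF this] obtain \<epsilon> where \<epsilon>: "\<And>e. \<epsilon> e \<longlonglongrightarrow> (0 :: real)"
    "\<And>e. \<forall>\<^sub>F n in sequentially. \<forall>S\<subseteq>{..<n}. norm (F n e S - c ^ card S * G n e) \<le> \<epsilon> e n"
    by blast
  have G: "(\<lambda>n. \<Sum>e\<in>?E. of_real (a e) * G n e) \<longlonglongrightarrow> 0"
  proof -
    have "(\<lambda>n. \<Sum>e\<in>?E. of_real (a e) * G n e) \<longlonglongrightarrow>
       (\<Sum>e\<in>?E. of_real (a e) * of_real (exp (- (p * (1 - p) * (of_int e * t)\<^sup>2) / 2)))"
      unfolding G_def using p by (intro tendsto_intros tendsto_biased_cube_cis) auto
    also have "(\<Sum>e\<in>?E. complex_of_real (a e) * of_real (exp (- (p * (1 - p) * (of_int e * t)\<^sup>2) / 2))) =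
      (\<Sum>e\<in>?E. of_real (wt e))"
    proof (intro sum.cong refl)
      fix e
      have "a e * exp (- (p * (1 - p) * (of_int e * t)\<^sup>2) / 2) = wt e"
        by (simp add: a_def exp_minus)
      then show "complex_of_real (a e) * of_real (exp (- (p * (1 - p) * (of_int e * t)\<^sup>2) / 2)) = of_real (wt e)"
        by (metis of_real_mult)
    qed
    also have "\<dots> = 0" by (simp add: wt_def)
    finally show ?thesis .
  qed
  define \<delta> where "\<delta> = (\<lambda>n. (\<Sum>e\<in>?E. \<bar>a e\<bar> * \<epsilon> e n) + norm (\<Sum>e\<in>?E. of_real (a e) * G n e))"
  have "\<delta> \<longlonglongrightarrow> (\<Sum>e\<in>?E. \<bar>a e\<bar> * 0) + norm (0 :: complex)"
    unfolding \<delta>_def by (intro tendsto_intros \<epsilon> G)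
  then have "\<delta> \<longlonglongrightarrow> 0" by simp
  moreover have "\<forall>\<^sub>F n in sequentially. \<forall>e\<in>?E. \<forall>S\<subseteq>{..<n}. norm (F n e S - c ^ card S * G n e) \<le> \<epsilon> e n"
    using \<epsilon>(2) by (intro eventually_ball_finite) auto
  then have "\<forall>\<^sub>F n in sequentially. \<forall>S\<subseteq>{..<n}.
    \<bar>measure_pmf.expectation (biased_cube p n) (\<lambda>x. bump (p * (1 - p)) t (zstat p n x) * chi S x)\<bar> \<le> \<delta> n"
  proof eventually_elim
    case (elim n)
    show ?case
    proof (intro allI impI)
      fix S assume S: "S \<subseteq> {..<n}"
      let ?x = "measure_pmf.expectation (biased_cube p n) (\<lambda>x. bump (p * (1 - p)) t (zstat p n x) * chi S x)"
      have "complex_of_real ?x = measure_pmf.expectation (biased_cube p n)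
          (\<lambda>x. complex_of_real (bump (p * (1 - p)) t (zstat p n x)) * of_real (chi S x))"
        unfolding of_real_mult[symmetric] integral_complex_of_real ..
      also have "\<dots> = measure_pmf.expectation (biased_cube p n)
          (\<lambda>x. \<Sum>e\<in>?E. of_real (a e) * (of_real (chi S x) * cis (of_int e * t * zstat p n x)))"
        unfolding bump_cis sum_distrib_right a_def by (simp add: mult_ac)
      also have "\<dots> = (\<Sum>e\<in>?E. of_real (a e) * F n e S)"
        unfolding F_def by (subst Bochner_Integration.integral_sum) simp_all
      also have "\<dots> = (\<Sum>e\<in>?E. of_real (a e) * (F n e S - c ^ card S * G n e)) +
          c ^ card S * (\<Sum>e\<in>?E. of_real (a e) * G n e)"
        unfolding sum_distrib_left sum.distrib[symmetric] by (intro sum.cong) (auto simp: algebra_simps)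
      finally have "\<bar>?x\<bar> = norm ((\<Sum>e\<in>?E. of_real (a e) * (F n e S - c ^ card S * G n e)) +
          c ^ card S * (\<Sum>e\<in>?E. of_real (a e) * G n e))"
        by (metis norm_of_real)
      also have "\<dots> \<le> (\<Sum>e\<in>?E. \<bar>a e\<bar> * \<epsilon> e n) + 1 * norm (\<Sum>e\<in>?E. of_real (a e) * G n e)"
      proof (rule order_trans[OF norm_triangle_ineq add_mono])
        show "norm (\<Sum>e\<in>?E. of_real (a e) * (F n e S - c ^ card S * G n e)) \<le> (\<Sum>e\<in>?E. \<bar>a e\<bar> * \<epsilon> e n)"
        proof (rule order_trans[OF norm_sum sum_mono])
          fix e assume "e \<in> ?E"
          then show "norm (of_real (a e) * (F n e S - c ^ card S * G n e)) \<le> \<bar>a e\<bar> * \<epsilon> e n"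
            unfolding norm_mult norm_of_real using elim S by (intro mult_left_mono) auto
        qed
        show "norm (c ^ card S * (\<Sum>e\<in>?E. of_real (a e) * G n e)) \<le> 1 * norm (\<Sum>e\<in>?E. of_real (a e) * G n e)"
          unfolding norm_mult norm_power using c by (intro mult_right_mono power_le_one) auto
      qed
      finally show "\<bar>?x\<bar> \<le> \<delta> n" by (simp add: \<delta>_def)
    qed
  qed
  ultimately show ?thesis by blast
qed


section \<open>The bounded construction\<close>

text \<open>All means are \<open>p\<close>, so the covariance is the mixed moment minus
  \<open>p\<^sup>2\<close>, and a witness against pairwise independence is a nonzero
  covariance.\<close>

lemma exists_neighbour:
  assumes p: "0 < p" "p < 1" and \<nu>: "\<nu> \<in> even_dists p k"
    and not_indep: "\<not> (\<exists>i<k. pairwise_indep_coord p k \<nu> i)" and i: "i < k"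
  shows "\<exists>j<k. j \<noteq> i \<and> covar p \<nu> i j \<noteq> 0"
proof -
  note [simp] = integrable_measure_pmf_finite[OF finite_even_dists[OF \<nu>]]
  obtain j where j: "j < k" "j \<noteq> i"
    "measure_pmf.expectation \<nu> (\<lambda>x. of_bool (x i) * of_bool (x j)) \<noteq> p\<^sup>2"
    using not_indep i by (auto simp: pairwise_indep_coord_def)
  have mean: "measure_pmf.expectation \<nu> (\<lambda>x. of_bool (x l)) = p" if "l < k" for l
    using mean_even_dists[OF \<nu> that, of of_bool] p by simp
  have "covar p \<nu> i j = measure_pmf.expectation \<nu>
      (\<lambda>x. of_bool (x i) * of_bool (x j) - p * of_bool (x i) - p * of_bool (x j) + p * p)"
    unfolding covar_def by (simp add: algebra_simps)
  also have "\<dots> = measure_pmf.expectation \<nu> (\<lambda>x. of_bool (x i) * of_bool (x j)) - p\<^sup>2"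
    using mean[OF i] mean[OF j(1)] by (simp add: power2_eq_square)
  finally show ?thesis using j by auto
qed

lemma covar_commute: "covar p \<nu> i j = covar p \<nu> j i"
  by (simp add: covar_def mult.commute)

lemma abs_bump_le: "\<bar>bump v r z\<bar> \<le> exp (v * r\<^sup>2 / 2) + 1"
proof -
  have "\<bar>exp (v * r\<^sup>2 / 2) * cos (r * z)\<bar> \<le> exp (v * r\<^sup>2 / 2) * 1"
    unfolding abs_mult by (intro mult_mono) auto
  then show ?thesis unfolding bump_def by linarith
qed

lemma bounded_construction:
  assumes p: "0 < p" "p < 1" and \<nu>: "\<nu> \<in> even_dists p k"
    and not_indep: "\<not> (\<exists>i<k. pairwise_indep_coord p k \<nu> i)"
  shows "\<exists>\<alpha>>0. \<exists>\<epsilon> :: nat \<Rightarrow> real. \<epsilon> \<longlonglongrightarrow> 0 \<and>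
        (\<forall>\<^sub>F n in sequentially. \<exists>f :: (nat \<Rightarrow> bool) \<Rightarrow> real.
           (\<forall>x\<in>cube n. f x \<in> {-1..1}) \<and>
           \<bar>measure_pmf.expectation (power_dist \<nu> n) (\<lambda>X. \<Prod>i<k. f (coord_vec n X i))\<bar> \<ge> \<alpha> \<and>
           (\<forall>S\<subseteq>{..<n}. \<bar>measure_pmf.expectation (biased_cube p n) (\<lambda>x. f x * chi S x)\<bar> \<le> \<epsilon> n))"
proof -
  note [simp] = integrable_measure_pmf_finite[OF finite_biased_cube]
    integrable_measure_pmf_finite[OF finite_power_dist[OF finite_even_dists[OF \<nu>]]]
  define v where "v = p * (1 - p)"
  obtain I r where I: "I \<subseteq> {..<k}"
    and G0: "(\<Sum>\<tau>\<in>{..<k} \<rightarrow>\<^sub>E I. gauss_moment k (covar p \<nu>) (r \<circ> \<tau>)) \<noteq> 0"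
    using exists_gauss_moment_nonzero[where C = "covar p \<nu>" and k = k]
      exists_neighbour[OF assms] covar_commute by metis
  define G where "G = (\<Sum>\<tau>\<in>{..<k} \<rightarrow>\<^sub>E I. gauss_moment k (covar p \<nu>) (r \<circ> \<tau>))"
  have finI: "finite I" using I finite_subset by blast
  \<comment> \<open>\<open>B\<close> dominates the sum of the bumps by \<open>abs_bump_le\<close>;
    the extra 1 keeps it positive even for empty \<open>I\<close>.\<close>
  define B where "B = (\<Sum>i\<in>I. exp (v * (r i)\<^sup>2 / 2) + 1) + 1"
  have B: "B > 0" unfolding B_def by (intro add_nonneg_pos sum_nonneg) (auto intro: add_nonneg_nonneg)
  define f where "f = (\<lambda>n x. (\<Sum>i\<in>I. bump v (r i) (zstat p n x)) / B)"
  have f_bound: "f n x \<in> {-1..1}" for n x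
  proof -
    have "\<bar>\<Sum>i\<in>I. bump v (r i) (zstat p n x)\<bar> \<le> (\<Sum>i\<in>I. exp (v * (r i)\<^sup>2 / 2) + 1)"
      by (rule order_trans[OF sum_abs sum_mono]) (rule abs_bump_le)
    also have "\<dots> \<le> B" by (simp add: B_def)
    finally have "\<bar>f n x\<bar> \<le> 1" using B by (simp add: f_def abs_divide)
    then show ?thesis by (simp add: abs_le_iff)
  qed
  \<comment> \<open>Choosing one bump for every slot amounts to choosing a map
    \<open>\<tau>\<close>; this produces the sum whose limit \<open>G\<close> is nonzero.\<close>
  have prod_f: "(\<Prod>i<k. f n (coord_vec n X i)) =
      (\<Sum>\<tau>\<in>{..<k} \<rightarrow>\<^sub>E I. \<Prod>i<k. bump v ((r \<circ> \<tau>) i) (zstat p n (coord_vec n X i))) / B ^ k" for n X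
    unfolding f_def prod_dividef by (subst prod_sum_PiE) (auto simp: finI)
  have "(\<lambda>n. measure_pmf.expectation (power_dist \<nu> n) (\<lambda>X. \<Prod>i<k. f n (coord_vec n X i))) =
    (\<lambda>n. (\<Sum>\<tau>\<in>{..<k} \<rightarrow>\<^sub>E I. measure_pmf.expectation (power_dist \<nu> n)
      (\<lambda>X. \<Prod>i<k. bump v ((r \<circ> \<tau>) i) (zstat p n (coord_vec n X i)))) / B ^ k)"
    unfolding prod_f by simp
  also have "\<dots> \<longlonglongrightarrow> G / B ^ k"
    unfolding G_def v_def using p B
    by (intro tendsto_divide tendsto_sum tendsto_power_dist_bump \<nu> tendsto_const) auto
  finally have "(\<lambda>n. \<bar>measure_pmf.expectation (power_dist \<nu> n) (\<lambda>X. \<Prod>i<k. f n (coord_vec n X i))\<bar>)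
    \<longlonglongrightarrow> \<bar>G / B ^ k\<bar>"
    by (rule tendsto_rabs)
  moreover have G: "\<bar>G / B ^ k\<bar> > 0" using G0 B by (simp add: G_def)
  ultimately have ev1: "\<forall>\<^sub>F n in sequentially. \<bar>G / B ^ k\<bar> / 2 <
    \<bar>measure_pmf.expectation (power_dist \<nu> n) (\<lambda>X. \<Prod>i<k. f n (coord_vec n X i))\<bar>"
    by (intro order_tendstoD) auto
  have "\<forall>i. \<exists>\<epsilon>. \<epsilon> \<longlonglongrightarrow> (0 :: real) \<and> (\<forall>\<^sub>F n in sequentially. \<forall>S\<subseteq>{..<n}.
    \<bar>measure_pmf.expectation (biased_cube p n) (\<lambda>x. bump v (r i) (zstat p n x) * chi S x)\<bar> \<le> \<epsilon> n)"
    unfolding v_def by (intro allI bump_chi_small p)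
  from choice[OF this] obtain \<epsilon> where \<epsilon>: "\<And>i. \<epsilon> i \<longlonglongrightarrow> (0 :: real)"
    "\<And>i. \<forall>\<^sub>F n in sequentially. \<forall>S\<subseteq>{..<n}.
    \<bar>measure_pmf.expectation (biased_cube p n) (\<lambda>x. bump v (r i) (zstat p n x) * chi S x)\<bar> \<le> \<epsilon> i n"
    by blast
  define \<delta> where "\<delta> = (\<lambda>n. (\<Sum>i\<in>I. \<epsilon> i n) / B)"
  have "\<delta> \<longlonglongrightarrow> (\<Sum>i\<in>I. 0) / B"
    unfolding \<delta>_def using B by (intro tendsto_intros \<epsilon>) auto
  then have \<delta>: "\<delta> \<longlonglongrightarrow> 0" by simp
  have "\<forall>\<^sub>F n in sequentially. \<forall>i\<in>I. \<forall>S\<subseteq>{..<n}.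
    \<bar>measure_pmf.expectation (biased_cube p n) (\<lambda>x. bump v (r i) (zstat p n x) * chi S x)\<bar> \<le> \<epsilon> i n"
    using \<epsilon>(2) finI by (intro eventually_ball_finite) auto
  then have ev2: "\<forall>\<^sub>F n in sequentially. \<forall>S\<subseteq>{..<n}.
    \<bar>measure_pmf.expectation (biased_cube p n) (\<lambda>x. f n x * chi S x)\<bar> \<le> \<delta> n"
  proof eventually_elim
    case (elim n)
    show ?case
    proof (intro allI impI)
      fix S assume S: "S \<subseteq> {..<n}"
      have "measure_pmf.expectation (biased_cube p n) (\<lambda>x. f n x * chi S x) =
        (\<Sum>i\<in>I. measure_pmf.expectation (biased_cube p n) (\<lambda>x. bump v (r i) (zstat p n x) * chi S x)) / B"
        unfolding f_def by (simp add: sum_distrib_right)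
      also have "\<bar>\<dots>\<bar> \<le> \<delta> n"
        unfolding abs_divide \<delta>_def using B elim S
        by (auto intro!: divide_right_mono order_trans[OF sum_abs sum_mono])
      finally show "\<bar>measure_pmf.expectation (biased_cube p n) (\<lambda>x. f n x * chi S x)\<bar> \<le> \<delta> n" .
    qed
  qed
  show ?thesis
  proof (intro exI conjI)
    show "\<bar>G / B ^ k\<bar> / 2 > 0" using G by simp
    show "\<forall>\<^sub>F n in sequentially. \<exists>f :: (nat \<Rightarrow> bool) \<Rightarrow> real.
           (\<forall>x\<in>cube n. f x \<in> {-1..1}) \<and>
           \<bar>measure_pmf.expectation (power_dist \<nu> n) (\<lambda>X. \<Prod>i<k. f (coord_vec n X i))\<bar> \<ge> \<bar>G / B ^ k\<bar> / 2 \<and>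
           (\<forall>S\<subseteq>{..<n}. \<bar>measure_pmf.expectation (biased_cube p n) (\<lambda>x. f x * chi S x)\<bar> \<le> \<delta> n)"
      using ev1 ev2
    proof eventually_elim
      case (elim n)
      then show ?case using f_bound[of n] by (intro exI[of _ "f n"]) auto
    qed
  qed (fact \<delta>)
qed

section \<open>Random rounding to signs\<close>

definition sign_pmf :: "real \<Rightarrow> real pmf" where
  "sign_pmf t = map_pmf (\<lambda>b. if b then 1 else - 1) (bernoulli_pmf ((1 + t) / 2))"

lemma set_sign_pmf: "set_pmf (sign_pmf t) \<subseteq> {-1, 1}"
  by (auto simp: sign_pmf_def)

lemma finite_set_sign_pmf: "finite (set_pmf (sign_pmf t))"
  using set_sign_pmf by (rule finite_subset) simp

lemma expectation_sign_pmf: "t \<in> {-1..1} \<Longrightarrow> measure_pmf.expectation (sign_pmf t) (\<lambda>s. s) = t"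
  by (simp add: sign_pmf_def field_simps)

definition round_pmf :: "'a set \<Rightarrow> ('a \<Rightarrow> real) \<Rightarrow> ('a \<Rightarrow> real) pmf" where
  "round_pmf A g = Pi_pmf A 0 (\<lambda>x. sign_pmf (g x))"

lemma finite_set_round_pmf: "finite A \<Longrightarrow> finite (set_pmf (round_pmf A g))"
  unfolding round_pmf_def by (rule finite_set_Pi_pmf) (auto simp: finite_set_sign_pmf)

lemma round_pmf_sign: "finite A \<Longrightarrow> f \<in> set_pmf (round_pmf A g) \<Longrightarrow> x \<in> A \<Longrightarrow> f x \<in> {-1, 1}"
  using set_sign_pmf by (fastforce simp: round_pmf_def set_Pi_pmf PiE_dflt_def)

text \<open>Values at distinct points are rounded independently and keep their means. Injectivity
  matters: a point \<open>x\<close> hit twice would contribute the mean 1 of a squared sign instead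
  of \<open>(g x)\<^sup>2\<close>.\<close>

lemma expectation_round_pmf_prod:
  assumes A: "finite A" and g: "\<And>x. x \<in> A \<Longrightarrow> g x \<in> {-1..1}"
    and y: "inj_on y K" "y ` K \<subseteq> A"
  shows "measure_pmf.expectation (round_pmf A g) (\<lambda>f. \<Prod>i\<in>K. f (y i)) = (\<Prod>i\<in>K. g (y i))"
proof -
  have restrict: "(\<Prod>i\<in>K. f (y i)) = (\<Prod>x\<in>A. if x \<in> y ` K then f x else 1)" for f :: "'a \<Rightarrow> real"
    using A y by (simp add: prod.reindex inf.absorb2 flip: prod.inter_restrict)
  have "measure_pmf.expectation (round_pmf A g) (\<lambda>f. \<Prod>i\<in>K. f (y i)) =
    (\<Prod>x\<in>A. measure_pmf.expectation (sign_pmf (g x)) (\<lambda>s. if x \<in> y ` K then s else 1))"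
    unfolding restrict round_pmf_def
    by (rule expectation_prod_Pi_pmf_finite[where h = "\<lambda>x s. if x \<in> y ` K then s else 1"])
       (simp_all add: A finite_set_sign_pmf)
  also have "\<dots> = (\<Prod>x\<in>A. if x \<in> y ` K then g x else 1)"
    using g by (intro prod.cong) (auto simp: expectation_sign_pmf simp del: atLeastAtMost_iff)
  finally show ?thesis unfolding restrict .
qed

text \<open>Hoeffding's inequality: the summand at \<open>x\<close> is confined to an interval of
  length \<open>2 * \<bar>a x\<bar>\<close>.\<close>

lemma round_pmf_concentration:
  assumes A: "finite A" and g: "\<And>x. x \<in> A \<Longrightarrow> g x \<in> {-1..1}"
    and "\<delta> \<ge> 0" and pos: "(\<Sum>x\<in>A. (a x)\<^sup>2) > 0"
  shows "measure_pmf.prob (round_pmf A g) {f. \<bar>(\<Sum>x\<in>A. a x * f x) - (\<Sum>x\<in>A. a x * g x)\<bar> \<ge> \<delta>}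
    \<le> 2 * exp (- \<delta>\<^sup>2 / (2 * (\<Sum>x\<in>A. (a x)\<^sup>2)))"
proof -
  have E: "measure_pmf.expectation (round_pmf A g) (\<lambda>f. a x * f x) = a x * g x" if "x \<in> A" for x
    using expectation_round_pmf_prod[OF A g, where y = "\<lambda>i. i" and K = "{x}"] that by simp
  interpret Hoeffding_ineq "measure_pmf (round_pmf A g)" A "\<lambda>x f. a x * f x" "\<lambda>x. - \<bar>a x\<bar>" "\<lambda>x. \<bar>a x\<bar>"
    "\<Sum>x\<in>A. a x * g x"
  proof unfold_locales
    show "prob_space.indep_vars (measure_pmf (round_pmf A g)) (\<lambda>_. borel) (\<lambda>x f. a x * f x) A"
      unfolding round_pmf_def
      by (rule prob_space.indep_vars_compose2[OF _ indep_vars_Pi_pmf])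
         (auto simp: A measure_pmf.prob_space_axioms)
    show "AE f in measure_pmf (round_pmf A g). a x * f x \<in> {- \<bar>a x\<bar>..\<bar>a x\<bar>}" if "x \<in> A" for x
    proof (rule AE_pmfI)
      fix f assume "f \<in> set_pmf (round_pmf A g)"
      then have "f x = -1 \<or> f x = 1" using round_pmf_sign[OF A _ that] by blast
      then show "a x * f x \<in> {- \<bar>a x\<bar>..\<bar>a x\<bar>}" by auto
    qed
    show "(\<Sum>x\<in>A. a x * g x) \<equiv> (\<Sum>x\<in>A. measure_pmf.expectation (round_pmf A g) (\<lambda>f. a x * f x))"
      by (intro eq_reflection sum.cong refl E[symmetric])
  qed (fact A)
  have sq: "(\<Sum>x\<in>A. (\<bar>a x\<bar> - - \<bar>a x\<bar>)\<^sup>2) = 4 * (\<Sum>x\<in>A. (a x)\<^sup>2)"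
    by (simp add: sum_distrib_left power_mult_distrib flip: mult_2)
  show ?thesis
    using Hoeffding_ineq_abs_ge[OF \<open>\<delta> \<ge> 0\<close>] pos unfolding sq by (simp add: mult.commute)
qed

section \<open>Point masses of the biased cube and uniform control of characters\<close>

lemma set_biased_cube_subset: "set_pmf (biased_cube p n) \<subseteq> cube n"
  using set_Pi_pmf_subset[of "{..<n}" undefined "\<lambda>_. bernoulli_pmf p"]
  by (auto simp: biased_cube_def cube_def PiE_def extensional_def)

lemma expectation_biased_cube:
  fixes h :: "(nat \<Rightarrow> bool) \<Rightarrow> real"
  shows "measure_pmf.expectation (biased_cube p n) h = (\<Sum>x\<in>cube n. pmf (biased_cube p n) x * h x)"
  using integral_measure_pmf[OF finite_cube, where M = "biased_cube p n" and f = h] set_biased_cube_subset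
  by (simp add: subset_iff)

lemma pmf_biased_cube_le:
  assumes p: "0 < p" "p < 1"
  shows "pmf (biased_cube p n) x \<le> max p (1 - p) ^ n"
proof -
  have le: "pmf (bernoulli_pmf p) b \<le> max p (1 - p)" for b using p by (cases b) auto
  have "(\<Prod>j<n. pmf (bernoulli_pmf p) (x j)) \<le> (\<Prod>j<n. max p (1 - p))"
    by (intro prod_mono) (auto simp: le simp del: pmf_bernoulli_True pmf_bernoulli_False)
  then show ?thesis using p by (auto simp: biased_cube_def pmf_Pi max_def)
qed

lemma sum_pmf_biased_cube: "(\<Sum>x\<in>cube n. pmf (biased_cube p n) x) = 1"
  by (rule sum_pmf_eq_1[OF finite_cube set_biased_cube_subset])

text \<open>One factor of each square is bounded by the largest point mass, and the other factors
  sum to 1. This sum plays the role of the variance in Hoeffding's inequality and is exponentially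
  small.\<close>

lemma sum_pmf_biased_cube_sq_le:
  assumes p: "0 < p" "p < 1"
  shows "(\<Sum>x\<in>cube n. (pmf (biased_cube p n) x)\<^sup>2) \<le> max p (1 - p) ^ n"
proof -
  have "(\<Sum>x\<in>cube n. (pmf (biased_cube p n) x)\<^sup>2) \<le> (\<Sum>x\<in>cube n. max p (1 - p) ^ n * pmf (biased_cube p n) x)"
    unfolding power2_eq_square by (intro sum_mono mult_right_mono pmf_biased_cube_le p) auto
  also have "\<dots> = max p (1 - p) ^ n"
    by (simp add: sum_pmf_biased_cube flip: sum_distrib_left)
  finally show ?thesis .
qed

lemma abs_chi [simp]: "\<bar>chi S x\<bar> = 1"
  by (simp add: chi_def abs_prod power_abs)

text \<open>Characters are signs, so the squared coefficients are the same for all \<open>S\<close>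
  and one Hoeffding bound serves them all. The factor \<open>2 ^ n\<close> is the union bound over
  the subsets.\<close>

lemma round_pmf_chi_concentration:
  assumes p: "0 < p" "p < 1" and g: "\<And>x. x \<in> cube n \<Longrightarrow> g x \<in> {-1..1}" and \<delta>: "\<delta> \<ge> 0"
  shows "measure_pmf.prob (round_pmf (cube n) g) {f. \<exists>S\<subseteq>{..<n}.
      \<bar>measure_pmf.expectation (biased_cube p n) (\<lambda>x. f x * chi S x) -
       measure_pmf.expectation (biased_cube p n) (\<lambda>x. g x * chi S x)\<bar> \<ge> \<delta>}
    \<le> 2 ^ n * (2 * exp (- \<delta>\<^sup>2 / (2 * max p (1 - p) ^ n)))"
proof -
  define c where "c = max p (1 - p)"
  have c: "c > 0" using p by (simp add: c_def)
  define bad where "bad = (\<lambda>S. {f. \<bar>measure_pmf.expectation (biased_cube p n) (\<lambda>x. f x * chi S x) -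
       measure_pmf.expectation (biased_cube p n) (\<lambda>x. g x * chi S x)\<bar> \<ge> \<delta>})"
  have sq: "(pmf (biased_cube p n) x * chi S x)\<^sup>2 = (pmf (biased_cube p n) x)\<^sup>2" for S x
    using abs_chi[of S x] by (simp add: power_mult_distrib flip: power2_abs[of "chi S x"])
  have pos: "(\<Sum>x\<in>cube n. (pmf (biased_cube p n) x)\<^sup>2) > 0"
  proof -
    obtain x where x: "x \<in> set_pmf (biased_cube p n)" using set_pmf_not_empty by fast
    then have "x \<in> cube n" using set_biased_cube_subset by blast
    then show ?thesis
      using x by (intro sum_pos2[OF finite_cube, of x]) (auto simp: set_pmf_iff)
  qed
  have bad_le: "measure_pmf.prob (round_pmf (cube n) g) (bad S) \<le> 2 * exp (- \<delta>\<^sup>2 / (2 * c ^ n))" for S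
  proof -
    have "measure_pmf.prob (round_pmf (cube n) g) (bad S)
      \<le> 2 * exp (- \<delta>\<^sup>2 / (2 * (\<Sum>x\<in>cube n. (pmf (biased_cube p n) x)\<^sup>2)))"
      unfolding bad_def expectation_biased_cube
      using round_pmf_concentration[where A = "cube n" and g = g and \<delta> = \<delta> and
          a = "\<lambda>x. pmf (biased_cube p n) x * chi S x", OF finite_cube g \<delta>] pos
      unfolding sq by (simp add: mult_ac)
    also have "\<dots> \<le> 2 * exp (- \<delta>\<^sup>2 / (2 * c ^ n))"
      using sum_pmf_biased_cube_sq_le[OF p, of n] pos
      by (auto simp: c_def intro!: divide_left_mono mult_pos_pos)
    finally show ?thesis .
  qed
  have "measure_pmf.prob (round_pmf (cube n) g) (\<Union>S\<in>Pow {..<n}. bad S)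
    \<le> (\<Sum>S\<in>Pow {..<n}. measure_pmf.prob (round_pmf (cube n) g) (bad S))"
    by (rule measure_UNION_le) auto
  also have "\<dots> \<le> (\<Sum>S\<in>Pow {..<n}. 2 * exp (- \<delta>\<^sup>2 / (2 * c ^ n)))"
    by (intro sum_mono bad_le)
  also have "\<dots> = 2 ^ n * (2 * exp (- \<delta>\<^sup>2 / (2 * c ^ n)))"
    by (simp add: card_Pow)
  also have "(\<Union>S\<in>Pow {..<n}. bad S) = {f. \<exists>S\<subseteq>{..<n}.
      \<bar>measure_pmf.expectation (biased_cube p n) (\<lambda>x. f x * chi S x) -
       measure_pmf.expectation (biased_cube p n) (\<lambda>x. g x * chi S x)\<bar> \<ge> \<delta>}"
    by (auto simp: bad_def)
  finally show ?thesis by (simp add: c_def)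
qed

text \<open>Two of the vectors coincide only if all \<open>n\<close> independent copies agree in the
  two coordinates, whence the \<open>n\<close>-th powers; a union bound over pairs finishes.\<close>

lemma prob_coord_vec_collision:
  "measure_pmf.prob (power_dist \<nu> n) {X. \<not> inj_on (coord_vec n X) {..<k}}
    \<le> (\<Sum>(i, j)\<in>{(i, j). i < k \<and> j < k \<and> i \<noteq> j}. measure_pmf.prob \<nu> {x. x i = x j} ^ n)"
proof -
  define P where "P = {(i, j). i < k \<and> j < k \<and> i \<noteq> j}"
  have finP: "finite P" unfolding P_def by (rule finite_subset[of _ "{..<k} \<times> {..<k}"]) auto
  have "{X. \<not> inj_on (coord_vec n X) {..<k}} \<subseteq>
      (\<Union>(i, j)\<in>P. Pi {..<n} (\<lambda>_. {x. x i = x j}))"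
    by (fastforce simp: inj_on_def P_def coord_vec_def restrict_def Pi_def fun_eq_iff split: if_splits)
  then have "measure_pmf.prob (power_dist \<nu> n) {X. \<not> inj_on (coord_vec n X) {..<k}} \<le>
      measure_pmf.prob (power_dist \<nu> n) (\<Union>q\<in>P. case q of (i, j) \<Rightarrow> Pi {..<n} (\<lambda>_. {x. x i = x j}))"
    by (intro measure_pmf.finite_measure_mono) auto
  also have "\<dots> \<le> (\<Sum>q\<in>P. measure_pmf.prob (power_dist \<nu> n) (case q of (i, j) \<Rightarrow> Pi {..<n} (\<lambda>_. {x. x i = x j})))"
    by (rule measure_UNION_le[OF finP]) auto
  also have "\<dots> = (\<Sum>(i, j)\<in>P. measure_pmf.prob \<nu> {x. x i = x j} ^ n)"
    by (intro sum.cong) (auto simp: power_dist_def measure_Pi_pmf_Pi)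
  finally show ?thesis by (simp add: P_def)
qed

text \<open>The two averages are exchanged, so that the rounding is averaged first for fixed
  \<open>X\<close>. For distinct vectors this gives exactly the product of the values of
  \<open>g\<close>; otherwise both quantities have modulus at most 1, whence the factor 2.\<close>

lemma expectation_round_power_dist:
  fixes k :: nat
  assumes fin: "finite (set_pmf \<nu>)" and g: "\<And>x. x \<in> cube n \<Longrightarrow> g x \<in> {-1..1}"
  defines "T \<equiv> \<lambda>f :: (nat \<Rightarrow> bool) \<Rightarrow> real.
    measure_pmf.expectation (power_dist \<nu> n) (\<lambda>X. \<Prod>i<k. f (coord_vec n X i))"
  shows "\<bar>measure_pmf.expectation (round_pmf (cube n) g) T - T g\<bar>
    \<le> 2 * measure_pmf.prob (power_dist \<nu> n) {X. \<not> inj_on (coord_vec n X) {..<k}}"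
proof -
  note finP = finite_power_dist[OF fin, of n]
  note [simp] = integrable_measure_pmf_finite[OF finP]
    integrable_measure_pmf_finite[OF finite_set_round_pmf[OF finite_cube]]
  define R where "R = round_pmf (cube n) g"
  define h where "h = (\<lambda>X. measure_pmf.expectation R (\<lambda>f. \<Prod>i<k. f (coord_vec n X i)))"
  define d where "d = (\<lambda>X. h X - (\<Prod>i<k. g (coord_vec n X i)))"
  have in_cube: "coord_vec n X i \<in> cube n" for X i by (auto simp: coord_vec_def cube_def)
  have sum_T: "T f = (\<Sum>X\<in>set_pmf (power_dist \<nu> n). pmf (power_dist \<nu> n) X * (\<Prod>i<k. f (coord_vec n X i)))" for f
    unfolding T_def by (subst integral_measure_pmf[OF finP]) auto
  have "measure_pmf.expectation R T = (\<Sum>X\<in>set_pmf (power_dist \<nu> n). pmf (power_dist \<nu> n) X * h X)"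
    unfolding sum_T h_def R_def by simp
  also have "\<dots> = measure_pmf.expectation (power_dist \<nu> n) h"
    by (subst integral_measure_pmf[OF finP]) auto
  finally have "measure_pmf.expectation R T - T g = measure_pmf.expectation (power_dist \<nu> n) d"
    by (simp add: T_def d_def)
  also have "\<bar>\<dots>\<bar> \<le> measure_pmf.expectation (power_dist \<nu> n)
      (\<lambda>X. 2 * indicator {X. \<not> inj_on (coord_vec n X) {..<k}} X)"
  proof (rule order_trans[OF integral_abs_bound integral_mono])
    fix X
    show "\<bar>d X\<bar> \<le> 2 * indicator {X. \<not> inj_on (coord_vec n X) {..<k}} X"
    proof (cases "inj_on (coord_vec n X) {..<k}")
      case True
      then have "h X = (\<Prod>i<k. g (coord_vec n X i))"
        unfolding h_def R_def using in_cube
        by (intro expectation_round_pmf_prod finite_cube g) auto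
      then show ?thesis by (simp add: d_def)
    next
      case False
      have "\<bar>\<Prod>i<k. g (coord_vec n X i)\<bar> \<le> 1"
        unfolding abs_prod using g[OF in_cube] by (intro prod_le_1) (auto simp: abs_le_iff)
      moreover have "\<bar>h X\<bar> \<le> 1"
      proof -
        have "AE f in measure_pmf R. \<bar>\<Prod>i<k. f (coord_vec n X i)\<bar> \<le> 1"
        proof (rule AE_pmfI)
          fix f assume "f \<in> set_pmf R"
          then have "f (coord_vec n X i) \<in> {-1, 1}" for i
            unfolding R_def using in_cube by (rule round_pmf_sign[OF finite_cube])
          then have "\<bar>f (coord_vec n X i)\<bar> = 1" for i by (metis abs_1 abs_minus_cancel insertE singletonD)
          then show "\<bar>\<Prod>i<k. f (coord_vec n X i)\<bar> \<le> 1" unfolding abs_prod by simp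
        qed
        then have "measure_pmf.expectation R (\<lambda>f. \<bar>\<Prod>i<k. f (coord_vec n X i)\<bar>) \<le> 1"
          unfolding R_def by (intro measure_pmf.integral_le_const) simp_all
        then show ?thesis
          unfolding h_def by (rule order_trans[OF integral_abs_bound])
      qed
      ultimately show ?thesis using False unfolding d_def by simp
    qed
  qed simp_all
  also have "\<dots> = 2 * measure_pmf.prob (power_dist \<nu> n) {X. \<not> inj_on (coord_vec n X) {..<k}}"
    by simp
  finally show ?thesis by (simp add: R_def)
qed

text \<open>A first-moment argument. If no rounding worked, every sign function outside
  \<open>Bad\<close> would have correlation below \<open>\<alpha> / 2\<close>, so the mean absolute
  correlation would be at most \<open>\<alpha> / 2\<close> plus the probability of
  \<open>Bad\<close>. But the mean correlation has modulus at least \<open>\<alpha>\<close> minus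
  twice the collision probability, which contradicts \<open>small\<close>.\<close>

lemma exists_sign_rounding:
  assumes p: "0 < p" "p < 1" and fin: "finite (set_pmf \<nu>)"
    and g: "\<And>x. x \<in> cube n \<Longrightarrow> g x \<in> {-1..1}" and "\<delta> \<ge> 0"
    and large: "\<bar>measure_pmf.expectation (power_dist \<nu> n) (\<lambda>X. \<Prod>i<k. g (coord_vec n X i))\<bar> \<ge> \<alpha>"
    and small: "2 ^ n * (2 * exp (- \<delta>\<^sup>2 / (2 * max p (1 - p) ^ n))) +
      2 * measure_pmf.prob (power_dist \<nu> n) {X. \<not> inj_on (coord_vec n X) {..<k}} < \<alpha> / 2"
  shows "\<exists>f. (\<forall>x\<in>cube n. f x \<in> {-1, 1}) \<and>
    \<bar>measure_pmf.expectation (power_dist \<nu> n) (\<lambda>X. \<Prod>i<k. f (coord_vec n X i))\<bar> \<ge> \<alpha> / 2 \<and>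
    (\<forall>S\<subseteq>{..<n}. \<bar>measure_pmf.expectation (biased_cube p n) (\<lambda>x. f x * chi S x) -
       measure_pmf.expectation (biased_cube p n) (\<lambda>x. g x * chi S x)\<bar> < \<delta>)"
proof (rule ccontr)
  assume contra: "\<not> ?thesis"
  note [simp] = integrable_measure_pmf_finite[OF finite_set_round_pmf[OF finite_cube]]
  define R where "R = round_pmf (cube n) g"
  define T where "T = (\<lambda>f :: (nat \<Rightarrow> bool) \<Rightarrow> real.
    measure_pmf.expectation (power_dist \<nu> n) (\<lambda>X. \<Prod>i<k. f (coord_vec n X i)))"
  define Bad where "Bad = {f. \<exists>S\<subseteq>{..<n}.
      \<bar>measure_pmf.expectation (biased_cube p n) (\<lambda>x. f x * chi S x) -
       measure_pmf.expectation (biased_cube p n) (\<lambda>x. g x * chi S x)\<bar> \<ge> \<delta>}"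
  have in_cube: "coord_vec n X i \<in> cube n" for X i by (auto simp: coord_vec_def cube_def)
  have "\<bar>T f\<bar> \<le> \<alpha> / 2 + indicator Bad f" if f: "f \<in> set_pmf R" for f
  proof -
    have sign: "f x \<in> {-1, 1}" if "x \<in> cube n" for x
      using f that unfolding R_def by (rule round_pmf_sign[OF finite_cube])
    show ?thesis
    proof (cases "f \<in> Bad")
      case True
      \<comment> \<open>On \<open>Bad\<close> the trivial bound 1 is absorbed by the indicator,
        \<open>\<alpha> / 2\<close> being positive.\<close>
      have "\<bar>f (coord_vec n X i)\<bar> = 1" for X i
        using sign[OF in_cube] by (metis abs_1 abs_minus_cancel insertE singletonD)
      then have "\<bar>\<Prod>i<k. f (coord_vec n X i)\<bar> = 1" for X unfolding abs_prod by simp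
      then have "\<bar>T f\<bar> \<le> 1"
        unfolding T_def by (rule_tac order_trans[OF integral_abs_bound]) simp
      moreover have "0 < \<alpha> / 2" by (rule le_less_trans[OF _ small]) simp
      ultimately show ?thesis using True by simp
    next
      case False
      then have "\<forall>S\<subseteq>{..<n}. \<bar>measure_pmf.expectation (biased_cube p n) (\<lambda>x. f x * chi S x) -
       measure_pmf.expectation (biased_cube p n) (\<lambda>x. g x * chi S x)\<bar> < \<delta>"
        unfolding Bad_def by (simp add: not_le)
      then have "\<not> \<bar>T f\<bar> \<ge> \<alpha> / 2"
        using contra sign unfolding T_def by blast
      then show ?thesis using False by simp
    qed
  qed
  then have "measure_pmf.expectation R (\<lambda>f. \<bar>T f\<bar>) \<le> measure_pmf.expectation R (\<lambda>f. \<alpha> / 2 + indicator Bad f)"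
    unfolding R_def by (intro integral_mono_AE AE_pmfI) simp_all
  also have "\<dots> = \<alpha> / 2 + measure_pmf.prob R Bad"
    unfolding R_def by simp
  also have "measure_pmf.prob R Bad \<le> 2 ^ n * (2 * exp (- \<delta>\<^sup>2 / (2 * max p (1 - p) ^ n)))"
    unfolding R_def Bad_def using p g \<open>\<delta> \<ge> 0\<close> by (rule round_pmf_chi_concentration)
  finally have "measure_pmf.expectation R (\<lambda>f. \<bar>T f\<bar>) \<le>
      \<alpha> / 2 + 2 ^ n * (2 * exp (- \<delta>\<^sup>2 / (2 * max p (1 - p) ^ n)))" by simp
  moreover have "\<bar>measure_pmf.expectation R T\<bar> \<le> measure_pmf.expectation R (\<lambda>f. \<bar>T f\<bar>)"
    by (rule integral_abs_bound)
  moreover have "\<bar>measure_pmf.expectation R T - T g\<bar> \<le>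
      2 * measure_pmf.prob (power_dist \<nu> n) {X. \<not> inj_on (coord_vec n X) {..<k}}"
    unfolding R_def T_def using fin g by (rule expectation_round_power_dist)
  moreover have "\<bar>T g\<bar> \<ge> \<alpha>" using large by (simp add: T_def)
  ultimately show False using small by linarith
qed

text \<open>The functions are rounded with tolerance \<open>d ^ n\<close>, which tends to 0 and so
  can be added to \<open>\<epsilon> n\<close>, but is still much larger than
  \<open>sqrt (c ^ n)\<close>, the bound on the scale of the random fluctuations.\<close>

lemma sign_construction:
  assumes p: "0 < p" "p < 1" and fin: "finite (set_pmf \<nu>)"
    and distinct: "\<And>i j. \<lbrakk>i < k; j < k; i \<noteq> j\<rbrakk> \<Longrightarrow> measure_pmf.prob \<nu> {x. x i = x j} < 1"
    and "\<alpha> > 0" and \<epsilon>: "\<epsilon> \<longlonglongrightarrow> 0"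
    and bounded: "\<forall>\<^sub>F n in sequentially. \<exists>f :: (nat \<Rightarrow> bool) \<Rightarrow> real.
           (\<forall>x\<in>cube n. f x \<in> {-1..1}) \<and>
           \<bar>measure_pmf.expectation (power_dist \<nu> n) (\<lambda>X. \<Prod>i<k. f (coord_vec n X i))\<bar> \<ge> \<alpha> \<and>
           (\<forall>S\<subseteq>{..<n}. \<bar>measure_pmf.expectation (biased_cube p n) (\<lambda>x. f x * chi S x)\<bar> \<le> \<epsilon> n)"
  shows "\<exists>\<alpha>>0. \<exists>\<epsilon> :: nat \<Rightarrow> real. \<epsilon> \<longlonglongrightarrow> 0 \<and>
        (\<forall>\<^sub>F n in sequentially. \<exists>f :: (nat \<Rightarrow> bool) \<Rightarrow> real.
           (\<forall>x\<in>cube n. f x \<in> {-1, 1}) \<and>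
           \<bar>measure_pmf.expectation (power_dist \<nu> n) (\<lambda>X. \<Prod>i<k. f (coord_vec n X i))\<bar> \<ge> \<alpha> \<and>
           (\<forall>S\<subseteq>{..<n}. \<bar>measure_pmf.expectation (biased_cube p n) (\<lambda>x. f x * chi S x)\<bar> \<le> \<epsilon> n))"
proof -
  define c where "c = max p (1 - p)"
  have c: "0 < c" "c < 1" using p by (auto simp: c_def)
  \<comment> \<open>With the fourth root of \<open>c\<close>, the ratio
    \<open>(d ^ n)\<^sup>2 / c ^ n\<close> equals \<open>(1 / d\<^sup>2) ^ n\<close>. It grows
    exponentially, so the Hoeffding term is doubly exponentially small and beats
    \<open>2 ^ n\<close>.\<close>
  define d where "d = sqrt (sqrt c)"
  have d: "0 < d" "d < 1" using c by (auto simp: d_def)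
  have d4: "c = d ^ 4"
  proof -
    have "d ^ 4 = (d\<^sup>2)\<^sup>2" by simp
    then show ?thesis using c by (simp add: d_def)
  qed
  define \<beta> where "\<beta> = (\<lambda>n. \<Sum>(i, j)\<in>{(i, j). i < k \<and> j < k \<and> i \<noteq> j}. measure_pmf.prob \<nu> {x. x i = x j} ^ n)"
  have \<beta>: "\<beta> \<longlonglongrightarrow> 0"
    unfolding \<beta>_def by (rule tendsto_null_sum) (auto intro!: LIMSEQ_power_zero simp: distinct)
  have "(\<lambda>n. 2 ^ n * (2 * exp (- (d ^ n)\<^sup>2 / (2 * c ^ n)))) \<longlonglongrightarrow> 0"
  proof -
    define e where "e = 1 / d\<^sup>2"
    have e: "e > 1" using d by (simp add: e_def power_less_one_iff)
    have "- (d ^ n)\<^sup>2 / (2 * c ^ n) = - (e ^ n) / 2" for n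
      using d(1) unfolding d4 e_def
      by (simp add: field_simps flip: power_mult power_add)
    moreover have "(\<lambda>n. 2 ^ n * (2 * exp (- (e ^ n) / 2))) \<longlonglongrightarrow> 0"
      using e by real_asymp
    ultimately show ?thesis by (simp only:)
  qed
  then have "(\<lambda>n. 2 ^ n * (2 * exp (- (d ^ n)\<^sup>2 / (2 * c ^ n))) + 2 * \<beta> n) \<longlonglongrightarrow> 0 + 2 * 0"
    by (intro tendsto_intros \<beta>)
  then have "\<forall>\<^sub>F n in sequentially. 2 ^ n * (2 * exp (- (d ^ n)\<^sup>2 / (2 * c ^ n))) + 2 * \<beta> n < \<alpha> / 2"
    using \<open>\<alpha> > 0\<close> by (intro order_tendstoD) auto
  with bounded have "\<forall>\<^sub>F n in sequentially. \<exists>f :: (nat \<Rightarrow> bool) \<Rightarrow> real.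
           (\<forall>x\<in>cube n. f x \<in> {-1, 1}) \<and>
           \<bar>measure_pmf.expectation (power_dist \<nu> n) (\<lambda>X. \<Prod>i<k. f (coord_vec n X i))\<bar> \<ge> \<alpha> / 2 \<and>
           (\<forall>S\<subseteq>{..<n}. \<bar>measure_pmf.expectation (biased_cube p n) (\<lambda>x. f x * chi S x)\<bar> \<le> \<epsilon> n + d ^ n)"
  proof eventually_elim
    case (elim n)
    then obtain g where g: "\<And>x. x \<in> cube n \<Longrightarrow> g x \<in> {-1..1}"
      "\<bar>measure_pmf.expectation (power_dist \<nu> n) (\<lambda>X. \<Prod>i<k. g (coord_vec n X i))\<bar> \<ge> \<alpha>"
      and g_chi: "\<And>S. S \<subseteq> {..<n} \<Longrightarrow> \<bar>measure_pmf.expectation (biased_cube p n) (\<lambda>x. g x * chi S x)\<bar> \<le> \<epsilon> n"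
      by blast
    have "2 ^ n * (2 * exp (- (d ^ n)\<^sup>2 / (2 * max p (1 - p) ^ n))) +
      2 * measure_pmf.prob (power_dist \<nu> n) {X. \<not> inj_on (coord_vec n X) {..<k}} < \<alpha> / 2"
      using elim(2) prob_coord_vec_collision[of \<nu> n k] unfolding \<beta>_def c_def by linarith
    from exists_sign_rounding[OF p fin g(1) _ g(2) this] obtain f where
      f: "\<forall>x\<in>cube n. f x \<in> {-1, 1}"
        "\<bar>measure_pmf.expectation (power_dist \<nu> n) (\<lambda>X. \<Prod>i<k. f (coord_vec n X i))\<bar> \<ge> \<alpha> / 2"
      and f_chi: "\<And>S. S \<subseteq> {..<n} \<Longrightarrow> \<bar>measure_pmf.expectation (biased_cube p n) (\<lambda>x. f x * chi S x) -
       measure_pmf.expectation (biased_cube p n) (\<lambda>x. g x * chi S x)\<bar> < d ^ n"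
      using d by auto
    have "\<bar>measure_pmf.expectation (biased_cube p n) (\<lambda>x. f x * chi S x)\<bar> \<le> \<epsilon> n + d ^ n"
      if "S \<subseteq> {..<n}" for S
      using g_chi[OF that] f_chi[OF that] by linarith
    with f show ?case by blast
  qed
  moreover have "(\<lambda>n. \<epsilon> n + d ^ n) \<longlonglongrightarrow> 0 + 0"
    using d by (intro tendsto_add \<epsilon> LIMSEQ_power_zero) auto
  ultimately show ?thesis
    using \<open>\<alpha> > 0\<close> by (intro exI[of _ "\<alpha> / 2"] conjI exI[of _ "\<lambda>n. \<epsilon> n + d ^ n"]) auto
qed

lemma prob_eq_less_one_if_max_agreement:
  assumes "max_agreement k \<nu> < 1" "i < k" "j < k" "i \<noteq> j"
  shows "measure_pmf.prob \<nu> {x. x i = x j} < 1"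
proof -
  let ?A = "{measure_pmf.prob \<nu> {x. x i = x j} | i j. i < k \<and> j < k \<and> i \<noteq> j}"
  have "?A \<subseteq> (\<lambda>(i, j). measure_pmf.prob \<nu> {x. x i = x j}) ` ({..<k} \<times> {..<k})" by auto
  then have "finite ?A" by (rule finite_subset) simp
  then have "measure_pmf.prob \<nu> {x. x i = x j} \<le> max_agreement k \<nu>"
    unfolding max_agreement_def using assms by (intro Max_ge) auto
  then show ?thesis using assms by simp
qed

theorem theorem4p1:
  fixes k :: nat and p :: real and \<nu> :: "(nat \<Rightarrow> bool) pmf"
  assumes "0 < p" and "p < 1"
    and "\<nu> \<in> even_dists p k"
    and "\<not> (\<exists>i<k. pairwise_indep_coord p k \<nu> i)"
  shows
    "(\<exists>\<alpha>>0. \<exists>\<epsilon> :: nat \<Rightarrow> real. \<epsilon> \<longlonglongrightarrow> 0 \<and>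
        (\<forall>\<^sub>F n in sequentially. \<exists>f :: (nat \<Rightarrow> bool) \<Rightarrow> real.
           (\<forall>x\<in>cube n. f x \<in> {-1..1}) \<and>
           \<bar>measure_pmf.expectation (power_dist \<nu> n) (\<lambda>X. \<Prod>i<k. f (coord_vec n X i))\<bar> \<ge> \<alpha> \<and>
           (\<forall>S\<subseteq>{..<n}. \<bar>measure_pmf.expectation (biased_cube p n) (\<lambda>x. f x * chi S x)\<bar> \<le> \<epsilon> n)))
     \<and>
     (max_agreement k \<nu> < 1 \<longrightarrow>
      (\<exists>\<alpha>>0. \<exists>\<epsilon> :: nat \<Rightarrow> real. \<epsilon> \<longlonglongrightarrow> 0 \<and>
        (\<forall>\<^sub>F n in sequentially. \<exists>f :: (nat \<Rightarrow> bool) \<Rightarrow> real.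
           (\<forall>x\<in>cube n. f x \<in> {-1, 1}) \<and>
           \<bar>measure_pmf.expectation (power_dist \<nu> n) (\<lambda>X. \<Prod>i<k. f (coord_vec n X i))\<bar> \<ge> \<alpha> \<and>
           (\<forall>S\<subseteq>{..<n}. \<bar>measure_pmf.expectation (biased_cube p n) (\<lambda>x. f x * chi S x)\<bar> \<le> \<epsilon> n))))"
proof (intro conjI impI)
  note bounded = bounded_construction[OF assms]
  then show "\<exists>\<alpha>>0. \<exists>\<epsilon> :: nat \<Rightarrow> real. \<epsilon> \<longlonglongrightarrow> 0 \<and>
        (\<forall>\<^sub>F n in sequentially. \<exists>f :: (nat \<Rightarrow> bool) \<Rightarrow> real.
           (\<forall>x\<in>cube n. f x \<in> {-1..1}) \<and>
           \<bar>measure_pmf.expectation (power_dist \<nu> n) (\<lambda>X. \<Prod>i<k. f (coord_vec n X i))\<bar> \<ge> \<alpha> \<and>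
           (\<forall>S\<subseteq>{..<n}. \<bar>measure_pmf.expectation (biased_cube p n) (\<lambda>x. f x * chi S x)\<bar> \<le> \<epsilon> n))" .
  assume "max_agreement k \<nu> < 1"
  note distinct = prob_eq_less_one_if_max_agreement[OF this]
  from bounded obtain \<alpha> \<epsilon> where "\<alpha> > 0" "\<epsilon> \<longlonglongrightarrow> 0"
    "\<forall>\<^sub>F n in sequentially. \<exists>f :: (nat \<Rightarrow> bool) \<Rightarrow> real.
           (\<forall>x\<in>cube n. f x \<in> {-1..1}) \<and>
           \<bar>measure_pmf.expectation (power_dist \<nu> n) (\<lambda>X. \<Prod>i<k. f (coord_vec n X i))\<bar> \<ge> \<alpha> \<and>
           (\<forall>S\<subseteq>{..<n}. \<bar>measure_pmf.expectation (biased_cube p n) (\<lambda>x. f x * chi S x)\<bar> \<le> \<epsilon> n)"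
    by blast
  then show "\<exists>\<alpha>>0. \<exists>\<epsilon> :: nat \<Rightarrow> real. \<epsilon> \<longlonglongrightarrow> 0 \<and>
        (\<forall>\<^sub>F n in sequentially. \<exists>f :: (nat \<Rightarrow> bool) \<Rightarrow> real.
           (\<forall>x\<in>cube n. f x \<in> {-1, 1}) \<and>
           \<bar>measure_pmf.expectation (power_dist \<nu> n) (\<lambda>X. \<Prod>i<k. f (coord_vec n X i))\<bar> \<ge> \<alpha> \<and>
           (\<forall>S\<subseteq>{..<n}. \<bar>measure_pmf.expectation (biased_cube p n) (\<lambda>x. f x * chi S x)\<bar> \<le> \<epsilon> n))"
    by (intro sign_construction[OF assms(1,2) finite_even_dists[OF assms(3)] distinct])
qed

end
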